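(* Let $F(n)$ denote the average number of comparisons (mean over all $n!$ orderings of $n$ distinct input elements) performed by MergeInsertion to sort $n$ elements. For $n \ge 1$ let $x_n \in [0,1)$ be the fractional part of $\log_2(3n)$, i.e. the unique value with $n = 2^{k-\log_2 3 + x_n}$ for some $k \in \mathbb{Z}$, and define $c:[0,1)\to\mathbb{R}$ by $$c(x) = (3-\log_2 3) - (2 - x - 2^{1-x}) + (1-2^{-x})\left(\frac{3}{2^x+1}-1\right) + \frac{2^{\log_2 3 - x}}{2292}.$$ Then $F(n) \le n\log_2 n - c(x_n)\, n + O(\log^2 n)$, and $c(x) \ge 1.4005$ for all $x \in [0,1)$. In particular the average number of comparisons is at most $n\log_2 n - 1.4005\,n + O(\log^2 n)$.
   Context: MergeInsertion (Ford–Johnson algorithm) sorts $n$ distinct elements as follows. (1) Form $\lfloor n/2\rfloor$ pairs and compare each pair (one comparison each); call the larger elements $a_i$ and the smaller $b_i$ with $a_i > b_i$; if $n$ is odd the leftover element is $b_{\lceil n/2\rceil}$. (2) Recursively sort $a_1,\dots,a_{\lfloor n/2\rfloor}$ with MergeInsertion and rename the pairs so that $a_1 < a_2 < \dots < a_{\lfloor n/2\rfloor}$ and still $a_i > b_i$. (3) The main chain initially is $b_1 < a_1 < \dots < a_{\lfloor n/2\rfloor}$ ($b_1$ is placed without comparison). With $t_k = \frac{2^{k+1}+(-1)^k}{3}$, for $k = 2,3,\dots$ the $k$-th batch inserts $b_{t_k}, b_{t_k-1},\dots,b_{t_{k-1}+1}$ in that order (skipping indices $> \lceil n/2\rceil$);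 each $b_i$ is inserted by binary insertion into the part of the current main chain consisting of elements smaller than $a_i$ (or into the whole main chain if $b_i$ has no partner $a_i$). Binary insertion into a sorted list of $m$ elements uses a decision tree with all leaves on at most two consecutive levels; the paper's convention is the "left" strategy, which compares the element with the element at position $\max\{m-2^{r}+1,\,2^{r-1}\}$ where $r = \lfloor \log_2 m\rfloor$, and recurses on the appropriate side. $\log$ denotes $\log_2$. *)

theory Defs
  imports
    Complex_Main
    "HOL-Library.Discrete_Functions"
    "HOL-Library.Landau_Symbols"
    "HOL-Combinatorics.Multiset_Permutations"
begin

text \<open>
  Every sorting procedure below returns its result together with the number of comparisons
  performed. Elements are only ever ordered by the comparisons that are counted; all other
  tests are equality tests that locate an element already placed.
\<close>

text \<open>
  1-based position of the pivot in a sorted list of length \<open>m \<ge> 1\<close> (left strategy).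
  For \<open>m = 1\<close> the truncated exponent gives \<open>2 ^ 0\<close> instead of \<open>2 powr (-1)\<close>,
  which does not change the maximum.
\<close>
definition left_pivot :: "nat \<Rightarrow> nat" where
  "left_pivot m = (let r = floor_log m in max (m - 2 ^ r + 1) (2 ^ (r - 1)))"

lemma left_pivot_ge_1: "1 \<le> left_pivot m"
  by (simp add: left_pivot_def Let_def le_max_iff_disj)

lemma left_pivot_le:
  assumes "m > 0"
  shows "left_pivot m \<le> m"
proof -
  have "(2::nat) ^ floor_log m \<le> m"
    using assms by (rule floor_log_exp2_le)
  moreover have "(2::nat) ^ (floor_log m - 1) \<le> 2 ^ floor_log m"
    by (rule power_increasing) auto
  moreover have "(1::nat) \<le> 2 ^ floor_log m"
    by simp
  ultimately show ?thesis
    unfolding left_pivot_def Let_def by linarith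
qed

function binary_insert :: "'a::linorder \<Rightarrow> 'a list \<Rightarrow> 'a list \<times> nat" where
  "binary_insert x ys =
    (if ys = [] then ([x], 0)
     else
       let p = left_pivot (length ys);
           y = ys ! (p - 1);
           lo = take (p - 1) ys;
           hi = drop p ys
       in if x < y
          then (let (zs, c) = binary_insert x lo in (zs @ y # hi, c + 1))
          else (let (zs, c) = binary_insert x hi in (lo @ y # zs, c + 1)))"
  by pat_completeness auto
termination
proof (relation "measure (length \<circ> snd)", goal_cases)
  case 1
  then show ?case by simp
next
  case (2 x ys p)
  then show ?case
    using left_pivot_le[of "length ys"] left_pivot_ge_1[of "length ys"] by simp
next
  case (3 x ys p)
  then show ?case
    using left_pivot_ge_1[of "length ys"] by simp
qed

declare binary_insert.simps [simp del]

text \<open>Each pair is stored as (larger, smaller), at the cost of one comparison.\<close>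
fun pair_up :: "'a::linorder list \<Rightarrow> ('a \<times> 'a) list" where
  "pair_up (x # y # zs) = (if x < y then (y, x) else (x, y)) # pair_up zs"
| "pair_up _ = []"

lemma length_pair_up [simp]: "length (pair_up xs) = length xs div 2"
  by (induction xs rule: pair_up.induct) auto

definition leftover :: "'a list \<Rightarrow> 'a list" where
  "leftover xs = (if odd (length xs) then [last xs] else [])"

definition batch_end :: "nat \<Rightarrow> nat" where
  "batch_end k = nat ((2 ^ (k + 1) + (- 1) ^ k) div 3)"

text \<open>
  The indices in \<open>{2..N}\<close> in the order in which the \<open>b\<close>-elements are inserted. Since
  \<open>batch_end (N + 1) \<ge> N\<close>, all batches beyond number \<open>N + 1\<close> are empty.
\<close>
definition insertion_order :: "nat \<Rightarrow> nat list" where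
  "insertion_order N =
    filter (\<lambda>i. i \<le> N)
      (concat (map (\<lambda>k. rev [batch_end (k - 1) + 1 ..< batch_end k + 1]) [2 ..< N + 2]))"

text \<open>
  Insertion of \<open>b\<^sub>i\<close>; the lists are 0-based while \<open>i\<close> is 1-based. The main chain is sorted and
  contains \<open>a\<^sub>i\<close>, so its elements smaller than \<open>a\<^sub>i\<close> are those preceding \<open>a\<^sub>i\<close>.
\<close>
definition insert_b ::
    "'a::linorder list \<Rightarrow> 'a list \<Rightarrow> nat \<Rightarrow> 'a list \<times> nat \<Rightarrow> 'a list \<times> nat" where
  "insert_b as bs i st =
    (let (chain, c) = st;
         lower = (if i \<le> length as then takeWhile (\<lambda>y. y \<noteq> as ! (i - 1)) chain else chain);
         upper = drop (length lower) chain;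
         (zs, c') = binary_insert (bs ! (i - 1)) lower
     in (zs @ upper, c + c'))"

text \<open>
  Meant for lists of distinct elements: the partner of an \<open>a\<close>-element is looked up by value
  after the \<open>a\<close>-elements have been sorted.
\<close>
function merge_insertion :: "'a::linorder list \<Rightarrow> 'a list \<times> nat" where
  "merge_insertion xs =
    (if length xs < 2 then (xs, 0)
     else
       let ps = pair_up xs;
           (as, c1) = merge_insertion (map fst ps);
           bs = map (\<lambda>a. the (map_of ps a)) as @ leftover xs;
           (chain, c2) = fold (insert_b as bs) (insertion_order (length bs)) (hd bs # as, 0)
       in (chain, length ps + c1 + c2))"
  by pat_completeness auto
termination
  by (relation "measure length") auto

declare merge_insertion.simps [simp del]

definition avg_comparisons :: "nat \<Rightarrow> real" where
  "avg_comparisons n =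
    (\<Sum>xs\<in>permutations_of_set {..<n}. real (snd (merge_insertion xs))) / fact n"

definition xfrac :: "nat \<Rightarrow> real" where
  "xfrac n = frac (log 2 (3 * real n))"

lemma xfrac_characterization:
  assumes "n \<ge> 1"
  shows "x = xfrac n \<longleftrightarrow>
    x \<in> {0..<1} \<and> (\<exists>k::int. real n = 2 powr (of_int k - log 2 3 + x))"
proof -
  have eq: "real n = 2 powr (of_int k - log 2 3 + x) \<longleftrightarrow> log 2 (3 * real n) = of_int k + x"
    for k :: int
  proof -
    have "real n = 2 powr (of_int k - log 2 3 + x) \<longleftrightarrow> log 2 (real n) = of_int k - log 2 3 + x"
    proof
      assume "log 2 (real n) = of_int k - log 2 3 + x"
      then show "real n = 2 powr (of_int k - log 2 3 + x)"
        using assms powr_log_cancel[of 2 "real n"] by simp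
    qed simp
    also have "\<dots> \<longleftrightarrow> log 2 (3 * real n) = of_int k + x"
      using assms by (auto simp: log_mult)
    finally show ?thesis .
  qed
  show ?thesis
    unfolding eq xfrac_def using frac_unique_iff[of "log 2 (3 * real n)" x]
    by (auto simp: Ints_def algebra_simps)
qed

definition cfun :: "real \<Rightarrow> real" where
  "cfun x = (3 - log 2 3) - (2 - x - 2 powr (1 - x))
     + (1 - 2 powr (- x)) * (3 / (2 powr x + 1) - 1)
     + 2 powr (log 2 3 - x) / 2292"

end

theory Submission
  imports Defs "HOL-Analysis.Harmonic_Numbers"
begin

text \<open>
  After the recursive call the input is a uniformly random \<^emph>\<open>configuration\<close>: a labelling of
  \<open>a\<^sub>1 < \<dots> < a\<^sub>m\<close> and of the \<open>b\<^sub>i < a\<^sub>i\<close>. Inserting \<open>b\<^sub>i\<close> from the \<open>k\<close>-th batch into a chain of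
  \<open>M < 2\<^sup>k\<close> elements costs \<open>k\<close>, or only \<open>k - 1\<close> if it lands on one of the \<open>2\<^sup>k - (M + 1)\<close> leftmost slots.
  Given the order of the chain, swapping \<open>b\<^sub>i\<close> with its lower neighbour never violates a constraint,
  so lower slots are at least as likely as higher ones and the saving is at least
  \<open>2\<^sup>k / (M + 1) - 1\<close> on average. In the last, incomplete batch \<open>M\<close> is at most its worst-case value; in a
  complete batch \<open>2\<^sup>k - (M + 1)\<close> counts the \<open>b\<^sub>l\<close> of the batch above \<open>a\<^sub>i\<close>, and since \<open>b\<^sub>l\<close> is
  uniformly distributed among the \<open>a\<close>'s and the earlier \<open>b\<close>'s, each of them is above \<open>a\<^sub>i\<close> with
  probability at least \<open>(l - i) / (2 l)\<close>. The resulting recursion is solved by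
  \<open>n log n - c n\<close>, rewritten for fixed \<open>k\<close> as a Lipschitz function of \<open>n\<close>, up to an error of \<open>O(k)\<close>
  per level.
\<close>

section \<open>Binary insertion with the left strategy\<close>

text \<open>Chain lengths, ranks and earlier insertions are dependent random quantities. Everything
  is therefore counted over one finite set of configurations, fixed before any insertion, and only
  the relative order of the chain is conditioned on: it determines the lengths, while elements not
  yet inserted may lie anywhere. A swap upwards is legitimate only if all \<open>b\<close> of
  smaller index are already placed. The real insertion order puts larger indices of a batch in
  front, so it yields one-sided monotonicity; exact uniformity is obtained for a different chain,
  which is enough because the event "\<open>b\<^sub>l\<close> is above \<open>a\<^sub>i\<close>"
  does not refer to any insertion order.

  Without its last summand \<open>c\<close> has a minimum between 1.3999 and 1.4, near
  \<open>2 powr x = 3 / 2\<close>, so the bound 1.4005 rests on that summand, which is at least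
  1/1528. It comes from the complete batches: a saving of \<open>2 ^ k / 2292\<close> in batch
  \<open>k\<close> adds up geometrically over the batches of a level and again over the levels, so
  that up to lower order a single term of the same shape remains.\<close>

function insert_cost :: "nat \<Rightarrow> nat \<Rightarrow> nat" where
  "insert_cost m r =
    (if m = 0 then 0
     else let p = left_pivot m
       in Suc (if r < p then insert_cost (p - 1) r else insert_cost (m - p) (r - p)))"
  by pat_completeness auto
termination
proof (relation "measure fst", goal_cases)
  case (2 m r p)
  then show ?case
    using left_pivot_le[of m] left_pivot_ge_1[of m] by simp
next
  case (3 m r p)
  then show ?case
    using left_pivot_ge_1[of m] by simp
qed simp

declare insert_cost.simps [simp del]

lemma insert_cost_0 [simp]: "insert_cost 0 r = 0"
  by (simp add: insert_cost.simps)

text \<open>The path through the decision tree depends on the inserted element only through its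
  rank. This reduces average cost to counting configurations by rank.\<close>

lemma binary_insert_eq:
  assumes "sorted_wrt (<) ys" "x \<notin> set ys"
  shows "binary_insert x ys =
    (filter (\<lambda>y. y < x) ys @ x # filter (\<lambda>y. x < y) ys,
     insert_cost (length ys) (length (filter (\<lambda>y. y < x) ys)))"
  using assms
proof (induction "length ys" arbitrary: ys rule: less_induct)
  case less
  show ?case
  proof (cases "ys = []")
    case True
    then show ?thesis by (simp add: binary_insert.simps)
  next
    case False
    define p where "p = left_pivot (length ys)"
    define y where "y = ys ! (p - 1)"
    define lo where "lo = take (p - 1) ys"
    define hi where "hi = drop p ys"
    have p: "1 \<le> p" "p \<le> length ys"
      using left_pivot_ge_1 left_pivot_le False unfolding p_def by auto
    have ys: "ys = lo @ y # hi"
      using p id_take_nth_drop[of "p - 1" ys] unfolding lo_def hi_def y_def by simp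
    have len: "length lo = p - 1" "length hi = length ys - p"
      using p by (auto simp: lo_def hi_def)
    have sorted: "sorted_wrt (<) lo" "sorted_wrt (<) hi" "\<forall>z\<in>set lo. z < y" "\<forall>z\<in>set hi. y < z"
      using less.prems(1) unfolding ys by (auto simp: sorted_wrt_append)
    have x: "x \<notin> set lo" "x \<notin> set hi" "x \<noteq> y"
      using less.prems(2) unfolding ys by auto
    have unfold: "binary_insert x ys =
      (if x < y
          then (let (zs, c) = binary_insert x lo in (zs @ y # hi, c + 1))
          else (let (zs, c) = binary_insert x hi in (lo @ y # zs, c + 1)))"
      using False by (subst binary_insert.simps) (simp add: Let_def p_def y_def lo_def hi_def)
    have cost: "insert_cost (length ys) r =
        Suc (if r < p then insert_cost (p - 1) r else insert_cost (length ys - p) (r - p))" for r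
      using False by (subst insert_cost.simps) (simp add: Let_def p_def)
    show ?thesis
    proof (cases "x < y")
      case True
      have hi: "filter (\<lambda>y. y < x) hi = []" "filter (\<lambda>y. x < y) hi = hi"
        using sorted(4) True by (auto simp: filter_empty_conv filter_id_conv)
      have IH: "binary_insert x lo =
        (filter (\<lambda>y. y < x) lo @ x # filter (\<lambda>y. x < y) lo,
          insert_cost (length lo) (length (filter (\<lambda>y. y < x) lo)))"
        using less.hyps[of lo] len p sorted x by simp
      have "length (filter (\<lambda>y. y < x) ys) = length (filter (\<lambda>y. y < x) lo)"
        using True hi by (simp add: ys)
      moreover have "length (filter (\<lambda>y. y < x) lo) < p"
        using len p length_filter_le[of "\<lambda>y. y < x" lo] by linarith
      ultimately have "insert_cost (length ys) (length (filter (\<lambda>y. y < x) ys)) =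
          Suc (insert_cost (length lo) (length (filter (\<lambda>y. y < x) lo)))"
        by (simp add: cost len)
      then show ?thesis
        using True hi unfolding unfold IH by (simp add: ys)
    next
      case False
      then have yx: "y < x" using x by auto
      have lo: "filter (\<lambda>y. y < x) lo = lo" "filter (\<lambda>y. x < y) lo = []"
        using sorted(3) yx by (auto simp: filter_empty_conv filter_id_conv)
      have IH: "binary_insert x hi =
        (filter (\<lambda>y. y < x) hi @ x # filter (\<lambda>y. x < y) hi,
          insert_cost (length hi) (length (filter (\<lambda>y. y < x) hi)))"
        using less.hyps[of hi] len p sorted x by simp
      have "length (filter (\<lambda>y. y < x) ys) = p + length (filter (\<lambda>y. y < x) hi)"
        using yx lo len p by (simp add: ys)
      then have "insert_cost (length ys) (length (filter (\<lambda>y. y < x) ys)) =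
          Suc (insert_cost (length hi) (length (filter (\<lambda>y. y < x) hi)))"
        by (simp add: cost len)
      then show ?thesis
        using False yx lo unfolding unfold IH by (simp add: ys)
    qed
  qed
qed

text \<open>Either side of the pivot keeps fewer than \<open>2 ^ k\<close> elements, which is what
  the induction on the depth needs.\<close>

lemma left_pivot_bounds:
  assumes "0 < m" "m < 2 ^ Suc k"
  shows "left_pivot m \<le> 2 ^ k" "m - left_pivot m < 2 ^ k"
proof -
  define r where "r = floor_log m"
  have lo: "2 ^ r \<le> m" using assms(1) unfolding r_def by (rule floor_log_exp2_le)
  have hi: "m < 2 * 2 ^ r" using floor_log_exp2_gt[of m] unfolding r_def by simp
  have "(2::nat) ^ r < 2 ^ Suc k" using lo assms(2) by (rule le_less_trans)
  then have "r \<le> k" by (metis less_Suc_eq_le power_less_imp_less_exp one_less_numeral_iff semiring_norm(76))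
  then have le: "(2::nat) ^ r \<le> 2 ^ k" by simp
  have le': "(2::nat) ^ (r - 1) \<le> 2 ^ r" by simp
  have pivot: "left_pivot m = max (m - 2 ^ r + 1) (2 ^ (r - 1))"
    by (simp add: left_pivot_def Let_def r_def)
  show "left_pivot m \<le> 2 ^ k" unfolding pivot using lo hi le le' by linarith
  show "m - left_pivot m < 2 ^ k" unfolding pivot using lo hi le by linarith
qed

lemma insert_cost_le: "m < 2 ^ k \<Longrightarrow> insert_cost m r \<le> k"
proof (induction k arbitrary: m r)
  case (Suc k)
  show ?case
  proof (cases "m = 0")
    case False
    define p where "p = left_pivot m"
    have "p - 1 < 2 ^ k" "m - p < 2 ^ k"
      using left_pivot_bounds[of m k] left_pivot_ge_1[of m] Suc.prems False
      unfolding p_def by linarith+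
    then show ?thesis
      using Suc.IH False by (subst insert_cost.simps) (simp add: Let_def p_def[symmetric])
  qed simp
qed simp

text \<open>In the left strategy the leaves of smaller depth are the leftmost ones.\<close>
lemma insert_cost_less:
  assumes "2 ^ k \<le> Suc m" "r + m + 1 < 2 ^ Suc k"
  shows "insert_cost m r \<le> k"
  using assms
proof (induction k arbitrary: m r)
  case 0
  then show ?case by simp
next
  case (Suc k)
  show ?case
  proof (cases "m < 2 ^ Suc k")
    case True
    \<comment> \<open>Here \<open>m = 2 ^ Suc k - 1\<close>: the tree is perfect and has a single
      level of leaves.\<close>
    then show ?thesis by (rule insert_cost_le)
  next
    case False
    define p where "p = left_pivot m"
    have m: "m \<noteq> 0" "2 * 2 ^ k \<le> m" "m < 4 * 2 ^ k" using False Suc.prems by (auto intro: Nat.gr0I)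
    have "floor_log m = Suc k"
      using m by (intro floor_log_eqI) auto
    then have p: "p = max (m - 2 * 2 ^ k + 1) (2 ^ k)"
      by (simp add: p_def left_pivot_def Let_def)
    have cost: "insert_cost m r =
        Suc (if r < p then insert_cost (p - 1) r else insert_cost (m - p) (r - p))"
      using m by (subst insert_cost.simps) (simp add: Let_def p_def)
    show ?thesis
    proof (cases "2 ^ k \<le> m - 2 * 2 ^ k + 1")
      case True
      \<comment> \<open>The right subtree holds \<open>2 * 2 ^ k - 1\<close> elements and has only
        deep leaves, so all shallow leaves are on the left; the rank condition forces
        \<open>r < p\<close>.\<close>
      then have p': "p = m - 2 * 2 ^ k + 1" by (simp add: p)
      have "r < p" using True Suc.prems m unfolding p' by simp
      moreover have "insert_cost (p - 1) r \<le> k"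
        using True Suc.prems m unfolding p' by (intro Suc.IH) auto
      ultimately show ?thesis by (simp add: cost)
    next
      case False
      \<comment> \<open>Now the left subtree, with \<open>2 ^ k - 1\<close> elements, is perfect and
        entirely shallow; the remaining shallow leaves are leftmost in the right subtree.\<close>
      then have p': "p = 2 ^ k" by (simp add: p)
      have "insert_cost (p - 1) r \<le> k"
        unfolding p' by (rule insert_cost_le) simp
      moreover have "insert_cost (m - p) (r - p) \<le> k" if "\<not> r < p"
        using False Suc.prems m that unfolding p' by (intro Suc.IH) auto
      ultimately show ?thesis by (simp add: cost)
    qed
  qed
qed

section \<open>Exchanging neighbours in a configuration\<close>

text \<open>
  Position \<open>p < m\<close> of a configuration \<open>v\<close> holds the \<open>a\<close>-element with 0-based index \<open>p\<close>, position
  \<open>m + i\<close> the \<open>b\<close>-element with index \<open>i\<close>. For \<open>N = m + 1\<close> the last \<open>b\<close>-element is the unpaired one.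
\<close>
definition configs :: "nat \<Rightarrow> nat \<Rightarrow> (nat \<Rightarrow> nat) set" where
  "configs m N = {v. v permutes {..<m + N} \<and> strict_mono_on {..<m} v \<and> (\<forall>i<m. v (m + i) < v i)}"

lemma finite_configs [simp]: "finite (configs m N)"
  by (rule finite_subset[OF _ finite_permutations[of "{..<m + N}"]]) (auto simp: configs_def)

definition rank :: "nat set \<Rightarrow> (nat \<Rightarrow> 'a::linorder) \<Rightarrow> nat \<Rightarrow> nat" where
  "rank P v p = card {q \<in> P. v q < v p}"

definition order_on :: "nat set \<Rightarrow> (nat \<Rightarrow> 'a::linorder) \<Rightarrow> (nat \<times> nat) set" where
  "order_on P v = {(p, q) \<in> P \<times> P. v p < v q}"

text \<open>
  The length of the list into which \<open>b\<close>-element \<open>i\<close> is inserted when the positions \<open>P\<close> are on the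
  main chain; the unpaired element goes into the whole chain.
\<close>
definition chain_len :: "nat \<Rightarrow> nat set \<Rightarrow> nat \<Rightarrow> (nat \<Rightarrow> 'a::linorder) \<Rightarrow> nat" where
  "chain_len m P i v = (if i < m then rank P v i else card P)"

lemma rank_order_on: "p \<in> P \<Longrightarrow> rank P v p = card {q. (q, p) \<in> order_on P v}"
  unfolding rank_def order_on_def by (rule arg_cong[where f = card]) auto

lemma chain_len_cong:
  assumes "{..<m} \<subseteq> P" "order_on P v = order_on P w"
  shows "chain_len m P i v = chain_len m P i w"
  using assms by (auto simp: chain_len_def rank_order_on subset_iff)

lemma rank_le_card: "finite P \<Longrightarrow> rank P v p \<le> card P"
  unfolding rank_def by (rule card_mono) auto

lemma rank_mono: "finite P \<Longrightarrow> v p \<le> v q \<Longrightarrow> rank P v p \<le> rank P v q"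
  unfolding rank_def by (rule card_mono) auto

lemma rank_less: "finite P \<Longrightarrow> p \<in> P \<Longrightarrow> v p < v q \<Longrightarrow> rank P v p < rank P v q"
  unfolding rank_def by (rule psubset_card_mono) auto

lemma rank_less_iff: "finite P \<Longrightarrow> p \<in> P \<Longrightarrow> rank P v p < rank P v q \<longleftrightarrow> v p < v q"
  by (meson linorder_not_less rank_less rank_mono)

lemma rank_surj:
  assumes "finite P" "inj_on v P" "r < card P"
  shows "\<exists>c\<in>P. rank P v c = r"
proof -
  have "inj_on (rank P v) P"
  proof (rule inj_onI)
    fix p q assume pq: "p \<in> P" "q \<in> P" "rank P v p = rank P v q"
    then have "v p = v q"
      using rank_less[OF assms(1), of p v q] rank_less[OF assms(1), of q v p]
      by (cases "v p" "v q" rule: linorder_cases) auto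
    then show "p = q" using assms(2) pq by (auto dest: inj_onD)
  qed
  moreover have "rank P v ` P \<subseteq> {..<card P}"
    unfolding rank_def using assms(1) by (auto intro!: psubset_card_mono)
  ultimately have "rank P v ` P = {..<card P}"
    by (metis card_image card_lessThan card_subset_eq finite_lessThan)
  then show ?thesis using assms(3) by (metis imageE lessThan_iff)
qed

text \<open>\<open>c\<close> and \<open>b\<close> are neighbours only as far as \<open>P\<close> can
  tell; elements outside \<open>P\<close> may lie between their values. The swap is thus invisible
  to the order of the chain.\<close>

lemma order_on_swap:
  assumes "c \<in> P" "b \<notin> P" "\<And>q. q \<in> P \<Longrightarrow> q \<noteq> c \<Longrightarrow> v q < v c \<longleftrightarrow> v q < v b"
    "inj v"
  shows "order_on P (v \<circ> Transposition.transpose c b) = order_on P v"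
proof -
  have "(v \<circ> Transposition.transpose c b) p < (v \<circ> Transposition.transpose c b) q \<longleftrightarrow> v p < v q" if "p \<in> P" "q \<in> P" for p q
  proof -
    have ne: "p \<noteq> b" "q \<noteq> b" using that assms by auto
    then have neq: "v p \<noteq> v b" "v q \<noteq> v b" using assms(4) by (auto simp: inj_eq)
    consider "p = c" "q = c" | "p = c" "q \<noteq> c" | "p \<noteq> c" "q = c" | "p \<noteq> c" "q \<noteq> c" by blast
    then show ?thesis
    proof cases
      case 2
      then have "v q \<noteq> v c" using assms(4) by (auto simp: inj_eq)
      then show ?thesis using 2 ne neq assms(3)[of q] that by (auto simp: Transposition.transpose_def)
    qed (use ne neq assms(3)[of p] that in \<open>auto simp: Transposition.transpose_def\<close>)
  qed
  then show ?thesis by (auto simp: order_on_def)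
qed

context
  fixes m N i :: nat and P :: "nat set"
  assumes m_le: "m \<le> N" and i: "i < N"
    and P: "{..<m} \<subseteq> P" "P \<subseteq> {..<m + N}" "m + i \<notin> P"
begin

lemma finite_P: "finite P"
  using P(2) finite_subset by blast

lemma rank_le_chain_len: "v \<in> configs m N \<Longrightarrow> rank P v (m + i) \<le> chain_len m P i v"
  using rank_le_card[OF finite_P, of v] rank_mono[OF finite_P, of v "m + i" i]
  by (auto simp: chain_len_def configs_def less_imp_le)

text \<open>If \<open>b\<^sub>i\<close> moves down past \<open>c\<close>, then \<open>c\<close>
  rises, and adjacency keeps it below its own partner. If \<open>b\<^sub>i\<close> moves up past an
  \<open>a\<close>-element \<open>c\<close>, that element drops and might fall below its partner;
  the condition \<open>{m..<m + i} \<subseteq> P\<close> puts this partner on the chain, where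
  adjacency protects it.\<close>

lemma swap_configs:
  assumes v: "v \<in> configs m N" and c: "c \<in> P"
    and adj: "\<And>q. q \<in> P \<Longrightarrow> q \<noteq> c \<Longrightarrow> v q < v c \<longleftrightarrow> v q < v (m + i)"
    and up: "v c > v (m + i) \<Longrightarrow> {m..<m + i} \<subseteq> P \<and> (i < m \<longrightarrow> v c < v i)"
  shows "v \<circ> Transposition.transpose c (m + i) \<in> configs m N"
proof -
  define b where "b = m + i"
  define v' where "v' = v \<circ> Transposition.transpose c b"
  have perm: "v permutes {..<m + N}" and mono: "strict_mono_on {..<m} v"
    and less: "\<And>l. l < m \<Longrightarrow> v (m + l) < v l"
    using v by (auto simp: configs_def)
  have inj: "inj v" using perm by (rule permutes_inj)
  have b: "b \<notin> P" "\<not> b < m" "b < m + N" using P i by (auto simp: b_def)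
  have adj': "q \<in> P \<Longrightarrow> q \<noteq> c \<Longrightarrow> v q < v c \<longleftrightarrow> v q < v b" for q
    using adj by (simp add: b_def)
  have ord: "order_on P v' = order_on P v"
    unfolding v'_def by (rule order_on_swap) (use c b adj' inj in auto)
  have "v' permutes {..<m + N}"
    unfolding v'_def using c P b by (intro permutes_compose permutes_swap_id perm) auto
  moreover have "strict_mono_on {..<m} v'"
  proof (rule strict_mono_onI)
    fix p q assume pq: "p \<in> {..<m}" "q \<in> {..<m}" "p < q"
    then have "(p, q) \<in> order_on P v"
      using mono P(1) by (auto simp: order_on_def strict_mono_on_def)
    then show "v' p < v' q" unfolding ord[symmetric] by (auto simp: order_on_def)
  qed
  moreover have "v' (m + l) < v' l" if l: "l < m" for l
  proof -
    have lP: "l \<in> P" "l \<noteq> b" using l P b by auto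
    have cb: "c \<noteq> b" using c b by auto
    consider "m + l = b" | "m + l = c" | "m + l \<noteq> b" "m + l \<noteq> c" by blast
    then show ?thesis
    proof cases
      case 1
      then have li: "l = i" by (simp add: b_def)
      have "v c < v i"
      proof (cases "v c > v b")
        case True
        then show ?thesis using up l li by (auto simp: b_def)
      next
        case False
        moreover have "v b < v i" using less l li by (simp add: b_def)
        ultimately show ?thesis by simp
      qed
      then have "c \<noteq> i" by auto
      then show ?thesis using 1 li \<open>v c < v i\<close> cb lP by (auto simp: v'_def Transposition.transpose_def)
    next
      case 2
      have "l \<noteq> c" using 2 l by (metis less_not_refl not_add_less1)
      have "v c < v l" using less[OF l] 2 by simp
      \<comment> \<open>\<open>c\<close> is the \<open>b\<close>-element of pair \<open>l\<close>;
        its partner is on the chain above \<open>c\<close>, hence by adjacency not below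
        \<open>b\<close>.\<close>
      then have "\<not> v l < v b" using adj'[OF lP(1) \<open>l \<noteq> c\<close>] by simp
      moreover have "v l \<noteq> v b" using lP inj by (auto simp: inj_eq)
      ultimately have "v b < v l" by simp
      then show ?thesis using 2 \<open>l \<noteq> c\<close> lP cb by (auto simp: v'_def Transposition.transpose_def)
    next
      case 3
      then have eq: "v' (m + l) = v (m + l)" by (simp add: v'_def Transposition.transpose_def)
      show ?thesis
      proof (cases "l = c")
        case True
        have "v (m + c) < v b"
        proof (cases "v c > v b")
          case True
          then have "{m..<m + i} \<subseteq> P" and ic: "i < m \<Longrightarrow> v c < v i" using up by (auto simp: b_def)
          \<comment> \<open>This places the partner \<open>m + c\<close> in
            \<open>{m..<m + i}\<close>. For the unpaired element it holds because every
            \<open>a\<close>-index is below \<open>m\<close>.\<close>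
          moreover have "c < i"
          proof (cases "i < m")
            case True
            show ?thesis
            proof (rule ccontr)
              assume "\<not> c < i"
              then have "v i \<le> v c"
                using strict_mono_on_leD[OF mono, of i c] True l \<open>l = c\<close> by simp
              then show False using ic True by simp
            qed
          next
            case False
            then show ?thesis using l \<open>l = c\<close> by simp
          qed
          ultimately have "m + c \<in> P" by auto
          moreover have "v (m + c) < v c" using less l \<open>l = c\<close> by simp
          ultimately show ?thesis using adj'[of "m + c"] l by simp
        next
          case False
          moreover have "v c \<noteq> v b" using cb inj by (auto simp: inj_eq)
          ultimately have "v c < v b" by simp
          then show ?thesis using less l \<open>l = c\<close> less_trans by blast
        qed
        then show ?thesis using eq True by (simp add: v'_def)
      next
        case False
        then show ?thesis using eq less[OF l] lP by (simp add: v'_def Transposition.transpose_def)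
      qed
    qed
  qed
  ultimately show ?thesis by (simp add: configs_def v'_def b_def)
qed

lemma inj_on_swap: "inj_on (\<lambda>v. v \<circ> Transposition.transpose c b) A"
  by (rule inj_on_inverseI[where g = "\<lambda>v. v \<circ> Transposition.transpose c b"]) (simp add: comp_assoc)

definition fiber :: "(nat \<times> nat) set \<Rightarrow> nat \<Rightarrow> (nat \<Rightarrow> nat) set" where
  "fiber \<kappa> r = {v \<in> configs m N. order_on P v = \<kappa> \<and> rank P v (m + i) = r}"

text \<open>The chain order \<open>\<kappa>\<close> alone determines the element \<open>c\<close> of
  rank \<open>r\<close>. Swapping with \<open>c\<close> is therefore one and the same involution on
  the whole fibre, and it maps rank \<open>Suc r\<close> injectively to rank
  \<open>r\<close>.\<close>

lemma fiber_antimono: "card (fiber \<kappa> (Suc r)) \<le> card (fiber \<kappa> r)"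
proof (cases "fiber \<kappa> (Suc r) = {}")
  case False
  define b where "b = m + i"
  obtain w where w: "w \<in> configs m N" "order_on P w = \<kappa>" "rank P w b = Suc r"
    using False by (auto simp: fiber_def b_def)
  have "r < card P" using w(3) rank_le_card[OF finite_P, of w b] by simp
  then obtain c where c: "c \<in> P" "rank P w c = r"
    using rank_surj[OF finite_P, of w r] w(1) by (auto simp: configs_def dest: permutes_inj_on)
  have "v \<circ> Transposition.transpose c b \<in> fiber \<kappa> r" if "v \<in> fiber \<kappa> (Suc r)" for v
  proof -
    have v: "v \<in> configs m N" "order_on P v = \<kappa>" "rank P v b = Suc r"
      using that by (auto simp: fiber_def b_def)
    have inj: "inj v" using v(1) by (auto simp: configs_def dest: permutes_inj)
    have vc: "rank P v c = r" using c w(2) v(2) by (simp add: rank_order_on)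
    then have less: "v c < v b" using v(3) c by (simp flip: rank_less_iff[OF finite_P])
    have "insert c {q \<in> P. v q < v c} = {q \<in> P. v q < v b}"
    proof (rule card_subset_eq)
      show "insert c {q \<in> P. v q < v c} \<subseteq> {q \<in> P. v q < v b}" using less c by auto
    qed (use vc v(3) finite_P in \<open>simp_all add: rank_def\<close>)
    then have adj: "v q < v c \<longleftrightarrow> v q < v b" if "q \<in> P" "q \<noteq> c" for q
      using that by blast
    have "v \<circ> Transposition.transpose c b \<in> configs m N"
      unfolding b_def by (rule swap_configs) (use v c adj less in \<open>auto simp: b_def\<close>)
    moreover have ord: "order_on P (v \<circ> Transposition.transpose c b) = \<kappa>"
      using order_on_swap[of c P b v] c adj inj v(2) P(3) by (simp add: b_def)
    moreover have "{q \<in> P. (v \<circ> Transposition.transpose c b) q < (v \<circ> Transposition.transpose c b) b} = {q \<in> P. v q < v c}"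
      using less P(3) by (auto simp: Transposition.transpose_def b_def)
    then have "rank P (v \<circ> Transposition.transpose c b) b = r"
      using vc unfolding rank_def by simp
    ultimately show ?thesis by (simp add: fiber_def b_def)
  qed
  then show ?thesis
    by (intro card_inj_on_le[OF inj_on_swap[of c b]]) (auto simp: fiber_def)
qed simp

text \<open>The inverse swap, upwards. \<open>r < chain_len m P i v\<close> says that the element
  passed is below \<open>a\<^sub>i\<close>, so \<open>b\<^sub>i\<close> stays below its partner.
  Together with \<open>fiber_antimono\<close> it gives a uniform rank.\<close>

lemma fiber_mono:
  assumes Pi: "{m..<m + i} \<subseteq> P" and r: "\<And>v. v \<in> fiber \<kappa> r \<Longrightarrow> r < chain_len m P i v"
  shows "card (fiber \<kappa> r) \<le> card (fiber \<kappa> (Suc r))"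
proof (cases "fiber \<kappa> r = {}")
  case False
  define b where "b = m + i"
  obtain w where w: "w \<in> configs m N" "order_on P w = \<kappa>" "w \<in> fiber \<kappa> r"
    using False by (auto simp: fiber_def b_def)
  have "chain_len m P i w \<le> card P"
    using rank_le_card[OF finite_P, of w i] by (simp add: chain_len_def)
  then have "r < card P" using r[OF w(3)] by simp
  then obtain c where c: "c \<in> P" "rank P w c = r"
    using rank_surj[OF finite_P, of w r] w(1) by (auto simp: configs_def dest: permutes_inj_on)
  have "v \<circ> Transposition.transpose c b \<in> fiber \<kappa> (Suc r)" if "v \<in> fiber \<kappa> r" for v
  proof -
    have v: "v \<in> configs m N" "order_on P v = \<kappa>" "rank P v b = r"
      using that by (auto simp: fiber_def b_def)
    have inj: "inj v" using v(1) by (auto simp: configs_def dest: permutes_inj)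
    have vc: "rank P v c = r" using c w(2) v(2) by (simp add: rank_order_on)
    have "\<not> v c < v b" using v(3) vc c by (simp flip: rank_less_iff[OF finite_P])
    moreover have "v c \<noteq> v b" using inj c P(3) by (auto simp: inj_eq b_def)
    ultimately have less: "v b < v c" by simp
    have "{q \<in> P. v q < v b} = {q \<in> P. v q < v c}"
    proof (rule card_subset_eq)
      show "{q \<in> P. v q < v b} \<subseteq> {q \<in> P. v q < v c}" using less by auto
    qed (use vc v(3) finite_P in \<open>simp_all add: rank_def\<close>)
    then have adj: "v q < v c \<longleftrightarrow> v q < v b" if "q \<in> P" "q \<noteq> c" for q
      using that by blast
    have up: "i < m \<Longrightarrow> v c < v i"
      using r[OF that] vc c by (simp add: chain_len_def flip: rank_less_iff[OF finite_P])
    have "v \<circ> Transposition.transpose c b \<in> configs m N"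
      unfolding b_def by (rule swap_configs) (use v c adj less up Pi in \<open>auto simp: b_def\<close>)
    moreover have ord: "order_on P (v \<circ> Transposition.transpose c b) = \<kappa>"
      using order_on_swap[of c P b v] c adj inj v(2) P(3) by (simp add: b_def)
    moreover have "{q \<in> P. (v \<circ> Transposition.transpose c b) q < (v \<circ> Transposition.transpose c b) b} =
        insert c {q \<in> P. v q < v c}"
      using less P(3) c by (auto simp: Transposition.transpose_def b_def)
    then have "rank P (v \<circ> Transposition.transpose c b) b = Suc r"
      using vc finite_P unfolding rank_def by simp
    ultimately show ?thesis by (simp add: fiber_def b_def)
  qed
  then show ?thesis
    by (intro card_inj_on_le[OF inj_on_swap[of c b]]) (auto simp: fiber_def)
qed simp


text \<open>A comparison of means without division: for \<open>d = Suc e\<close> the value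
  \<open>f e\<close> separates the first \<open>d\<close> terms from the later ones.\<close>

lemma antimono_prefix_sum:
  fixes f :: "nat \<Rightarrow> nat"
  assumes "\<And>r. f (Suc r) \<le> f r" "d \<le> Suc M"
  shows "d * (\<Sum>r<Suc M. f r) \<le> Suc M * (\<Sum>r<d. f r)"
proof (cases d)
  case 0
  then show ?thesis by simp
next
  case (Suc e)
  have anti: "f s \<le> f r" if "r \<le> s" for r s
    using assms(1) that by (rule lift_Suc_antimono_le)
  define A B where "A = (\<Sum>r<d. f r)" and "B = (\<Sum>r=d..<Suc M. f r)"
  have AB: "(\<Sum>r<Suc M. f r) = A + B"
    unfolding A_def B_def using sum.atLeastLessThan_concat[of 0 d "Suc M" f] assms(2)
    by (simp only: atLeast0LessThan)
  have "B \<le> (\<Sum>r=d..<Suc M. f e)"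
    unfolding B_def using Suc by (intro sum_mono anti) auto
  then have B: "B \<le> (Suc M - d) * f e" by (simp only: sum_constant card_atLeastLessThan) simp
  have "(\<Sum>r<d. f e) \<le> A"
    unfolding A_def using Suc by (intro sum_mono anti) auto
  then have A: "d * f e \<le> A" by simp
  have "d * B \<le> d * ((Suc M - d) * f e)" by (rule mult_le_mono2[OF B])
  also have "\<dots> = (Suc M - d) * (d * f e)" by (rule mult.left_commute)
  also have "\<dots> \<le> (Suc M - d) * A" by (rule mult_le_mono2[OF A])
  finally have "d * (A + B) \<le> (d + (Suc M - d)) * A"
    by (simp only: distrib_left distrib_right)
  also have "d + (Suc M - d) = Suc M" using assms(2) by simp
  finally show ?thesis unfolding AB by (simp only: A_def)
qed

text \<open>Total expectation: an average inequality may be checked within each class of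
  configurations with equal chain order.\<close>

lemma sum_fibers:
  fixes g :: "(nat \<Rightarrow> nat) \<Rightarrow> real"
  assumes "\<And>w. w \<in> configs m N \<Longrightarrow>
    0 \<le> sum g {v \<in> configs m N. order_on P v = order_on P w}"
  shows "0 \<le> sum g (configs m N)"
proof -
  have "sum g (configs m N) =
      (\<Sum>\<kappa>\<in>order_on P ` configs m N. sum g {v \<in> configs m N. order_on P v = \<kappa>})"
    by (rule sum.image_gen) simp
  also have "\<dots> \<ge> 0"
    by (rule sum_nonneg) (use assms in blast)
  finally show ?thesis .
qed

lemma card_fiber_union:
  "finite R \<Longrightarrow>
    card {v \<in> configs m N. order_on P v = \<kappa> \<and> rank P v (m + i) \<in> R} = (\<Sum>r\<in>R. card (fiber \<kappa> r))"
  by (subst card_UN_disjoint[symmetric])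
    (auto simp: fiber_def intro!: arg_cong[where f = card])

text \<open>Within a class the chain length \<open>M\<close> is constant and lower slots are at
  least as frequent, so the lowest \<open>d M\<close> of the \<open>Suc M\<close> slots carry at
  least their share. \<open>d\<close> is a function of the length because the number of cheap slots,
  \<open>2 ^ k - Suc M\<close>, is one.\<close>

lemma sum_rank_less_ge:
  fixes d :: "nat \<Rightarrow> nat"
  assumes d: "\<And>v. v \<in> configs m N \<Longrightarrow> d (chain_len m P i v) \<le> Suc (chain_len m P i v)"
  shows "(\<Sum>v\<in>configs m N. real (d (chain_len m P i v)) / real (Suc (chain_len m P i v)))
    \<le> (\<Sum>v\<in>configs m N. of_bool (rank P v (m + i) < d (chain_len m P i v)))"
proof -
  have "0 \<le> (\<Sum>v\<in>configs m N. of_bool (rank P v (m + i) < d (chain_len m P i v))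
      - real (d (chain_len m P i v)) / real (Suc (chain_len m P i v)))"
  proof (rule sum_fibers, goal_cases)
    case (1 w)
    define \<kappa> where "\<kappa> = order_on P w"
    define M where "M = chain_len m P i w"
    define X where "X = {v \<in> configs m N. order_on P v = \<kappa>}"
    have M: "chain_len m P i v = M" if "v \<in> X" for v
      using chain_len_cong[OF P(1), of v w i] that by (simp add: X_def \<kappa>_def M_def)
    have fin: "finite X" by (simp add: X_def)
    have "X = {v \<in> configs m N. order_on P v = \<kappa> \<and> rank P v (m + i) \<in> {..<Suc M}}"
      using rank_le_chain_len M by (force simp: X_def less_Suc_eq_le)
    then have "card X = (\<Sum>r<Suc M. card (fiber \<kappa> r))"
      using card_fiber_union[of "{..<Suc M}" \<kappa>] by simp
    moreover have "{v \<in> X. rank P v (m + i) < d M} =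
        {v \<in> configs m N. order_on P v = \<kappa> \<and> rank P v (m + i) \<in> {..<d M}}"
      by (auto simp: X_def)
    then have "card {v \<in> X. rank P v (m + i) < d M} = (\<Sum>r<d M. card (fiber \<kappa> r))"
      using card_fiber_union[of "{..<d M}" \<kappa>] by simp
    ultimately have "d M * card X \<le> Suc M * card {v \<in> X. rank P v (m + i) < d M}"
      using antimono_prefix_sum[of "\<lambda>r. card (fiber \<kappa> r)", OF fiber_antimono] d[OF 1]
      by (simp add: M_def)
    then have "real (d M) * real (card X) \<le> real (Suc M) * real (card {v \<in> X. rank P v (m + i) < d M})"
      by (simp only: of_nat_le_iff flip: of_nat_mult)
    then have "real (d M) / real (Suc M) * real (card X) \<le> real (card {v \<in> X. rank P v (m + i) < d M})"
      by (simp add: field_simps)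
    also have "\<dots> = (\<Sum>v\<in>X. of_bool (rank P v (m + i) < d M))"
      using fin by (simp add: sum_of_bool_eq Collect_conj_eq[symmetric] Int_def)
    also have "\<dots> = (\<Sum>v\<in>X. of_bool (rank P v (m + i) < d (chain_len m P i v)))"
      using M by (intro sum.cong) auto
    also have "real (d M) / real (Suc M) * real (card X) =
        (\<Sum>v\<in>X. real (d (chain_len m P i v)) / real (Suc (chain_len m P i v)))"
      using M by (simp add: sum.cong)
    finally show ?case
      unfolding X_def[symmetric] \<kappa>_def[symmetric] sum_subtractf by simp
  qed
  then show ?thesis by (simp add: sum_subtractf)
qed

end


section \<open>Uniform position of a \<open>b\<close>-element relative to all smaller
  indices\<close>

lemma chain_len_prefix:
  assumes v: "v \<in> configs m N" and j: "j \<le> m"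
  shows "chain_len m {..<m + j} j v = 2 * j"
proof (cases "j < m")
  case True
  have mono: "strict_mono_on {..<m} v" and less: "\<And>l. l < m \<Longrightarrow> v (m + l) < v l"
    using v by (auto simp: configs_def)
  have a: "v q < v j \<longleftrightarrow> q < j" if "q < m" for q
    using strict_mono_on_less[OF mono] that True by simp
  \<comment> \<open>Each \<open>b\<close> of index below \<open>j\<close> lies below
    \<open>a\<^sub>j\<close> because its partner does.\<close>
  have "{q \<in> {..<m + j}. v q < v j} = {..<j} \<union> {m..<m + j}"
  proof (intro subset_antisym subsetI)
    fix q assume q: "q \<in> {..<j} \<union> {m..<m + j}"
    show "q \<in> {q \<in> {..<m + j}. v q < v j}"
    proof (cases "q < m")
      case False
      then obtain l where l: "q = m + l" "l < j" using q j by (auto simp: le_iff_add)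
      then show ?thesis using less[of l] a[of l] True by simp
    qed (use q a j in auto)
  next
    fix q assume q: "q \<in> {q \<in> {..<m + j}. v q < v j}"
    show "q \<in> {..<j} \<union> {m..<m + j}"
    proof (cases "q < m")
      case True
      then show ?thesis using q a by simp
    qed (use q in auto)
  qed
  moreover have "card ({..<j} \<union> {m..<m + j}) = 2 * j"
    using True by (subst card_Un_disjoint) auto
  ultimately show ?thesis
    using True by (simp add: chain_len_def rank_def)
next
  case False
  then show ?thesis using j by (simp add: chain_len_def)
qed

text \<open>For the chain of all \<open>a\<close> and the \<open>b\<close> of index below
  \<open>j\<close>, swaps in both directions apply, so \<open>b\<^sub>j\<close> is uniform on
  \<open>2 * j + 1\<close> slots. Above \<open>a\<^sub>i\<close> there is at least one slot for each
  \<open>a\<close>-index from \<open>i\<close> to \<open>j - 1\<close>, since these elements lie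
  below the upper end of the range of \<open>b\<^sub>j\<close>.\<close>

lemma prob_b_above_a:
  assumes "m \<le> N" "j < N" "i < j" "j \<le> m"
  shows "real (card (configs m N)) * (real (j - i) / real (2 * j + 1))
    \<le> (\<Sum>v\<in>configs m N. of_bool (v i < v (m + j)))"
proof -
  define P where "P = {..<m + j}"
  have P: "{..<m} \<subseteq> P" "P \<subseteq> {..<m + N}" "m + j \<notin> P" "finite P" "{m..<m + j} \<subseteq> P"
    using assms by (auto simp: P_def)
  have M: "chain_len m P j v = 2 * j" if "v \<in> configs m N" for v
    using chain_len_prefix[OF that assms(4)] by (simp add: P_def)
  note le = rank_le_chain_len[OF assms(1,2) P(1-3)]
  note union = card_fiber_union[OF assms(1,2) P(1-3)]
  have "0 \<le> (\<Sum>v\<in>configs m N. of_bool (v i < v (m + j)) - real (j - i) / real (2 * j + 1))"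
  proof (rule sum_fibers[OF assms(1,2) P(1-3)], goal_cases)
    case (1 w)
    define \<kappa> where "\<kappa> = order_on P w"
    define \<rho> where "\<rho> = rank P w i"
    define X where "X = {v \<in> configs m N. order_on P v = \<kappa>}"
    define f where "f r = card (fiber m N j P \<kappa> r)" for r
    have fin: "finite X" by (simp add: X_def)
    have "f (Suc r) = f r" if "r < 2 * j" for r
    proof (rule antisym)
      show "f (Suc r) \<le> f r"
        unfolding f_def by (rule fiber_antimono[OF assms(1,2) P(1-3)])
      show "f r \<le> f (Suc r)"
        unfolding f_def using that M fiber_def[OF assms(1,2) P(1-3)]
        by (intro fiber_mono[OF assms(1,2) P(1-3)] P) auto
    qed
    then have f: "r \<le> 2 * j \<Longrightarrow> f r = f 0" for r
      by (induction r) auto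
    have "X = {v \<in> configs m N. order_on P v = \<kappa> \<and> rank P v (m + j) \<in> {..2 * j}}"
      using le M by (force simp: X_def)
    then have "card X = (\<Sum>r\<le>2 * j. f r)"
      using union[of "{..2 * j}" \<kappa>] by (simp add: f_def)
    also have "\<dots> = (\<Sum>r\<le>2 * j. f 0)" by (rule sum.cong[OF refl], rule f) simp
    finally have X: "card X = (2 * j + 1) * f 0" by simp
    have "v i < v (m + j) \<longleftrightarrow> \<rho> < rank P v (m + j)" if "v \<in> X" for v
    proof -
      have "i \<in> P" using assms by (auto simp: P_def)
      moreover from this have "rank P v i = \<rho>"
        using that by (simp add: rank_order_on X_def \<rho>_def \<kappa>_def)
      ultimately show ?thesis using rank_less_iff[OF P(4), of i v] by simp
    qed
    then have "{v \<in> X. v i < v (m + j)} =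
        {v \<in> configs m N. order_on P v = \<kappa> \<and> rank P v (m + j) \<in> {\<rho><..2 * j}}"
      using le M by (force simp: X_def)
    then have "card {v \<in> X. v i < v (m + j)} = (\<Sum>r\<in>{\<rho><..2 * j}. f r)"
      using union[of "{\<rho><..2 * j}" \<kappa>] by (simp add: f_def)
    also have "\<dots> = (\<Sum>r\<in>{\<rho><..2 * j}. f 0)" by (rule sum.cong[OF refl], rule f) simp
    finally have above: "card {v \<in> X. v i < v (m + j)} = (2 * j - \<rho>) * f 0" by simp
    have "\<rho> + (j - i) \<le> 2 * j"
    proof -
      define B where "B = (if j < m then {q \<in> P. w q < w j} else P)"
      have mono: "w p < w q" if "p < q" "q < m" for p q
        using 1 that by (auto simp: configs_def strict_mono_on_def)
      have "{q \<in> P. w q < w i} \<union> {i..<j} \<subseteq> B"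
        using mono[of i j] mono assms P(1) by (auto simp: B_def intro: less_trans)
      then have "card ({q \<in> P. w q < w i} \<union> {i..<j}) \<le> card B"
        by (rule card_mono[rotated]) (use P(4) in \<open>simp add: B_def\<close>)
      moreover have "card ({q \<in> P. w q < w i} \<union> {i..<j}) = \<rho> + (j - i)"
      proof (subst card_Un_disjoint)
        have "\<not> w q < w i" if "q \<in> {i..<j}" for q
          using mono[of i q] that assms by (cases "q = i") auto
        then show "{q \<in> P. w q < w i} \<inter> {i..<j} = {}" by auto
      qed (use P(4) in \<open>auto simp: \<rho>_def rank_def\<close>)
      moreover have "card B = 2 * j"
        using M[OF 1] by (simp add: B_def chain_len_def rank_def split: if_splits)
      ultimately show ?thesis by linarith
    qed
    then have "j - i \<le> 2 * j - \<rho>" by simp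
    then have "(j - i) * card X \<le> (2 * j + 1) * card {v \<in> X. v i < v (m + j)}"
      unfolding X above by (metis mult.commute mult.left_commute mult_le_mono2)
    then have "real (j - i) * real (card X) \<le> real (2 * j + 1) * real (card {v \<in> X. v i < v (m + j)})"
      by (simp only: of_nat_le_iff flip: of_nat_mult)
    then have "real (j - i) / real (2 * j + 1) * real (card X) \<le> real (card {v \<in> X. v i < v (m + j)})"
      by (simp add: field_simps)
    also have "\<dots> = (\<Sum>v\<in>X. of_bool (v i < v (m + j)))"
      using fin by (simp add: sum_of_bool_eq Collect_conj_eq[symmetric] Int_def)
    finally show ?case
      unfolding X_def[symmetric] \<kappa>_def[symmetric] by (simp add: sum_subtractf mult.commute)
  qed
  then show ?thesis by (simp add: sum_subtractf)
qed

section \<open>The cost of one level of the recursion\<close>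

lemma three_batch_end: "3 * int (batch_end k) = 2 ^ (k + 1) + (- 1) ^ k"
proof -
  have "3 dvd ((2::int) ^ (k + 1) + (- 1) ^ k)"
  proof (induction k)
    case (Suc k)
    have "(2::int) ^ (Suc k + 1) + (- 1) ^ Suc k = 2 * (2 ^ (k + 1) + (- 1) ^ k) - 3 * (- 1) ^ k"
      by (simp add: algebra_simps)
    then show ?case using Suc by (metis dvd_diff dvd_mult dvd_triv_left)
  qed simp
  moreover have nonneg: "(0::int) \<le> 2 ^ (k + 1) + (- 1) ^ k"
    using one_le_power[of "2::int" "k + 1"] by (cases "even k") auto
  moreover have "0 \<le> ((2::int) ^ (k + 1) + (- 1) ^ k) div 3"
    using nonneg by (simp only: pos_imp_zdiv_nonneg_iff[OF zero_less_numeral])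
  ultimately show ?thesis by (simp add: batch_end_def)
qed

text \<open>The identity behind the choice of the batches: a complete batch \<open>{u..<w}\<close>
  with number \<open>k\<close> has \<open>u + w = 2 ^ k\<close>, so each of its insertions is into
  fewer than \<open>2 ^ k\<close> elements.\<close>

lemma batch_end_Suc: "batch_end (Suc k) + batch_end k = 2 ^ (k + 1)"
proof -
  have "int (batch_end (Suc k) + batch_end k) = int (2 ^ (k + 1))"
    using three_batch_end[of k] three_batch_end[of "Suc k"] by simp
  then show ?thesis by (simp only: of_nat_eq_iff)
qed

lemma batch_end_1 [simp]: "batch_end (Suc 0) = 1"
  by (simp add: batch_end_def)

lemma batch_end_mono_Suc: "batch_end k \<le> batch_end (Suc k)"
proof -
  have "int (batch_end k) \<le> int (batch_end (Suc k))"
    using three_batch_end[of k] three_batch_end[of "Suc k"] one_le_power[of "2::int" k]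
    by (cases "even k") auto
  then show ?thesis by simp
qed

lemma batch_end_mono: "k \<le> l \<Longrightarrow> batch_end k \<le> batch_end l"
  using batch_end_mono_Suc by (rule lift_Suc_mono_le)

lemma batch_end_ge: "n \<le> batch_end (n + 1)"
proof -
  have "int n < 2 ^ n" by (rule of_nat_less_two_power)
  moreover have "3 * a \<le> 3 * (b - 1)" if "a < b" for a b :: int using that by simp
  ultimately have "3 * int n \<le> 3 * (2 ^ n - 1)" by blast
  also have "\<dots> \<le> 3 * int (batch_end (n + 1))"
    unfolding three_batch_end using one_le_power[of "2::int" n]
    by (cases "even n") (auto simp del: one_le_power)
  finally show ?thesis by simp
qed

section \<open>Simulation of the insertion phase by sets of positions\<close>

definition main_chain :: "(nat \<Rightarrow> 'a::linorder) \<Rightarrow> nat set \<Rightarrow> 'a list" where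
  "main_chain v P = sorted_list_of_set (v ` P)"

lemma strict_sorted_eq:
  fixes ys :: "'a::linorder list"
  assumes "sorted_wrt (<) ys"
  shows "ys = sorted_list_of_set (set ys)"
  using assms strict_sorted_equal[of ys "sorted_list_of_set (set ys)"] by simp

definition step_cost :: "nat \<Rightarrow> (nat \<Rightarrow> 'a::linorder) \<Rightarrow> nat set \<Rightarrow> nat \<Rightarrow> nat" where
  "step_cost m v P j = insert_cost (chain_len m P j v) (rank P v (m + j))"

lemma takeWhile_neq_sorted:
  fixes a :: "'a::linorder"
  assumes "sorted_wrt (<) ys" "a \<in> set ys"
  shows "takeWhile (\<lambda>y. y \<noteq> a) ys = filter (\<lambda>y. y < a) ys"
proof -
  obtain l r where ys: "ys = l @ a # r" using assms(2) by (meson split_list)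
  then have lr: "\<forall>y\<in>set l. y < a" "\<forall>y\<in>set r. a < y"
    using assms(1) by (auto simp: sorted_wrt_append)
  have "filter (\<lambda>y. y < a) l = l" "filter (\<lambda>y. y < a) r = []"
    using lr by (auto simp: filter_id_conv filter_empty_conv)
  moreover have "takeWhile (\<lambda>y. y \<noteq> a) ys = l"
    unfolding ys using lr by (subst takeWhile_append2) auto
  ultimately show ?thesis by (simp add: ys)
qed

lemma length_filter_main_chain:
  assumes "finite P" "inj_on v P"
  shows "length (filter (\<lambda>y. y < v p) (main_chain v P)) = rank P v p"
proof -
  have "length (filter (\<lambda>y. y < v p) (main_chain v P)) = card {y \<in> v ` P. y < v p}"
    unfolding main_chain_def using assms(1)
    by (subst distinct_card[symmetric]) auto
  also have "{y \<in> v ` P. y < v p} = v ` {q \<in> P. v q < v p}" by auto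
  also have "card \<dots> = rank P v p"
    unfolding rank_def using assms(2) by (intro card_image) (auto intro: inj_on_subset)
  finally show ?thesis .
qed

text \<open>
  The positions on the main chain just before \<open>b\<close>-element \<open>j\<close> is inserted in the batch
  \<open>{u..<w}\<close>; all indices are 0-based.
\<close>
definition present :: "nat \<Rightarrow> nat \<Rightarrow> nat \<Rightarrow> nat \<Rightarrow> nat set" where
  "present m u w j = {..<m + u} \<union> {m + Suc j..<m + w}"

definition batch_cost :: "nat \<Rightarrow> (nat \<Rightarrow> 'a::linorder) \<Rightarrow> nat \<Rightarrow> nat \<Rightarrow> nat" where
  "batch_cost m v u w = (\<Sum>j=u..<w. step_cost m v (present m u w j) j)"

definition total_insert_cost :: "nat \<Rightarrow> nat \<Rightarrow> (nat \<Rightarrow> 'a::linorder) \<Rightarrow> nat" where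
  "total_insert_cost m N v =
    (\<Sum>k=2..<N + 2. batch_cost m v (min (batch_end (k - 1)) N) (min (batch_end k) N))"

locale config =
  fixes m N :: nat and v :: "nat \<Rightarrow> 'a::linorder"
  assumes m_le_N: "m \<le> N"
    and inj: "inj_on v {..<m + N}"
    and mono: "strict_mono_on {..<m} v"
    and pair_less: "i < m \<Longrightarrow> v (m + i) < v i"
begin

text \<open>The invariant is that the chain is the sorted image of a set of positions. As
  \<open>b\<^sub>j\<close> is below \<open>a\<^sub>j\<close>, inserting it into the part below
  \<open>a\<^sub>j\<close> sorts it into the whole chain, and its rank in that part equals its rank
  in \<open>P\<close>.\<close>

lemma insert_b_eq:
  assumes P: "{..<m} \<subseteq> P" "P \<subseteq> {..<m + N}" "m + j \<notin> P" and j: "j < N"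
  shows "insert_b (map v [0..<m]) (map v [m..<m + N]) (Suc j) (main_chain v P, c) =
    (main_chain v (insert (m + j) P), c + step_cost m v P j)"
proof -
  define ys where "ys = main_chain v P"
  define x where "x = v (m + j)"
  define lower where
    "lower = (if Suc j \<le> length (map v [0..<m])
      then takeWhile (\<lambda>y. y \<noteq> map v [0..<m] ! (Suc j - 1)) ys else ys)"
  define upper where "upper = drop (length lower) ys"
  have fin: "finite P" using P(2) finite_subset by blast
  have injP: "inj_on v P" using inj P(2) by (rule inj_on_subset)
  have ys: "sorted_wrt (<) ys" "set ys = v ` P" using fin by (auto simp: ys_def main_chain_def)
  have low: "lower = (if j < m then filter (\<lambda>y. y < v j) ys else ys)"
    using takeWhile_neq_sorted[OF ys(1), of "v j"] ys(2) P(1)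
    by (auto simp: lower_def nth_append)
  have len: "length lower = chain_len m P j v"
    using length_filter_main_chain[OF fin injP] card_image[OF injP] fin
    by (auto simp: low chain_len_def ys_def) (simp add: main_chain_def)
  have "lower = take (length lower) ys"
    by (simp add: lower_def takeWhile_eq_take[symmetric])
  then have split: "ys = lower @ upper" by (metis append_take_drop_id upper_def)
  have x: "x \<notin> v ` P"
  proof
    assume "x \<in> v ` P"
    then obtain p where "p \<in> P" "v p = v (m + j)" unfolding x_def by (metis imageE)
    moreover from this have "p = m + j"
      using P(2) j by (intro inj_onD[OF inj]) auto
    ultimately show False using P(3) by simp
  qed
  have up: "x < y" if "y \<in> set upper" for y
  proof (cases "j < m")
    case True
    have "y \<notin> set lower"
      using ys(1) that unfolding split by (auto simp: sorted_wrt_append)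
    moreover have "y \<in> set ys" using that by (simp add: split)
    ultimately have "\<not> y < v j" using True by (simp add: low)
    then show ?thesis using pair_less[OF True] by (simp add: x_def)
  next
    case False
    then show ?thesis using that by (simp add: upper_def low)
  qed
  have sl: "sorted_wrt (<) lower" "sorted_wrt (<) upper" "\<And>y z. y \<in> set lower \<Longrightarrow> z \<in> set upper \<Longrightarrow> y < z"
    using ys(1) unfolding split by (auto simp: sorted_wrt_append)
  define zs where "zs = filter (\<lambda>y. y < x) lower @ x # filter (\<lambda>y. x < y) lower"
  have xl: "x \<notin> set lower" using x ys(2) split by auto
  have "filter (\<lambda>y. y < x) upper = []" using up by (auto simp: filter_empty_conv dest: less_asym)
  then have "filter (\<lambda>y. y < x) lower = filter (\<lambda>y. y < x) ys" by (simp add: split)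
  then have "length (filter (\<lambda>y. y < x) lower) = rank P v (m + j)"
    using length_filter_main_chain[OF fin injP] by (simp add: ys_def x_def)
  then have bin: "binary_insert x lower = (zs, step_cost m v P j)"
    using binary_insert_eq[OF sl(1) xl] by (simp add: zs_def step_cost_def len)
  have "sorted_wrt (<) (zs @ upper)"
    using sl up by (auto simp: zs_def sorted_wrt_append sorted_wrt_filter intro: less_trans)
  moreover have "set (zs @ upper) = v ` insert (m + j) P"
    using ys(2) xl unfolding split zs_def by (auto simp: x_def[symmetric])
  ultimately have "zs @ upper = main_chain v (insert (m + j) P)"
    unfolding main_chain_def by (metis strict_sorted_eq)
  moreover have "map v [m..<m + N] ! (Suc j - 1) = x" using j by (simp add: x_def)
  ultimately show ?thesis
    unfolding insert_b_def
    by (simp add: ys_def[symmetric] lower_def[symmetric, simplified] upper_def[symmetric] bin Let_def del: upt_Suc)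
qed

text \<open>Indices of a batch are inserted in decreasing order, hence the downward induction;
  \<open>s\<close> is the smallest index placed so far, and \<open>s = u\<close> ends the
  batch.\<close>

lemma fold_batch:
  assumes "u \<le> w" "w \<le> N" "s \<le> w" "u \<le> s"
  shows "fold (insert_b (map v [0..<m]) (map v [m..<m + N])) (rev [s + 1..<w + 1]) (main_chain v {..<m + u}, c) =
    (main_chain v ({..<m + u} \<union> {m + s..<m + w}), c + (\<Sum>j=s..<w. step_cost m v (present m u w j) j))"
  using assms(3,4)
proof (induction s rule: inc_induct)
  case (step s)
  have "fold (insert_b (map v [0..<m]) (map v [m..<m + N])) (rev [s + 1..<w + 1]) (main_chain v {..<m + u}, c) =
    insert_b (map v [0..<m]) (map v [m..<m + N]) (Suc s)
      (main_chain v (present m u w s), c + (\<Sum>j=Suc s..<w. step_cost m v (present m u w j) j))"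
    using step by (simp add: upt_conv_Cons present_def del: upt_Suc)
  also have "\<dots> = (main_chain v (insert (m + s) (present m u w s)),
      c + (\<Sum>j=Suc s..<w. step_cost m v (present m u w j) j) + step_cost m v (present m u w s) s)"
    using step assms by (intro insert_b_eq) (auto simp: present_def)
  also have "insert (m + s) (present m u w s) = {..<m + u} \<union> {m + s..<m + w}"
    using step by (auto simp: present_def)
  also have "c + (\<Sum>j=Suc s..<w. step_cost m v (present m u w j) j) + step_cost m v (present m u w s) s
      = c + (\<Sum>j=s..<w. step_cost m v (present m u w j) j)"
    using step by (simp add: sum.atLeast_Suc_lessThan)
  finally show ?case .
qed simp

lemma fold_insertion_order:
  assumes "0 < N"
  shows "fold (insert_b (map v [0..<m]) (map v [m..<m + N])) (insertion_order N) (main_chain v {..<m + 1}, 0) =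
    (main_chain v {..<m + N}, total_insert_cost m N v)"
proof -
  define U where "U k = min (batch_end k) N" for k
  \<comment> \<open>Filtering a batch amounts to capping both of its ends at \<open>N\<close>, so
    incomplete and empty batches need no separate treatment.\<close>
  have batch: "filter (\<lambda>i. i \<le> N) (rev [a + 1..<b + 1]) = rev [min a N + 1..<min b N + 1]" for a b
  proof -
    have "filter (\<lambda>i. i \<le> N) [a + 1..<b + 1] = [min a N + 1..<min b N + 1]"
      by (induction b) (auto simp: min_def not_less_eq_eq dest: antisym)
    then show ?thesis by (simp add: rev_filter[symmetric] del: upt_Suc)
  qed
  have U_mono: "U k \<le> U (Suc k)" for k
    using batch_end_mono_Suc[of k] by (auto simp: U_def)
  have "fold (insert_b (map v [0..<m]) (map v [m..<m + N]))
      (concat (map (\<lambda>k. rev [U (k - 1) + 1..<U k + 1]) [2..<K + 2])) (main_chain v {..<m + 1}, 0) =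
    (main_chain v {..<m + U (K + 1)}, (\<Sum>k=2..<K + 2. batch_cost m v (U (k - 1)) (U k)))" for K
  proof (induction K)
    case 0
    then show ?case using assms by (simp add: U_def)
  next
    case (Suc K)
    have "fold (insert_b (map v [0..<m]) (map v [m..<m + N])) (rev [U (K + 1) + 1..<U (K + 2) + 1])
      (main_chain v {..<m + U (K + 1)}, c) = (main_chain v {..<m + U (K + 2)}, c + batch_cost m v (U (K + 1)) (U (K + 2)))"
      for c
    proof -
      have "{..<m + U (K + 1)} \<union> {m + U (K + 1)..<m + U (K + 2)} = {..<m + U (K + 2)}"
        using U_mono[of "K + 1"] by auto
      then show ?thesis
        using U_mono[of "K + 1"] fold_batch[of "U (K + 1)" "U (K + 2)" "U (K + 1)" c]
        by (simp add: batch_cost_def U_def del: upt_Suc)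
    qed
    then show ?case using Suc by (simp add: upt_Suc_append[of 2] del: upt_Suc)
  qed
  moreover have "U (N + 1) = N" using batch_end_ge[of N] by (simp add: U_def)
  moreover have "insertion_order N = concat (map (\<lambda>k. rev [U (k - 1) + 1..<U k + 1]) [2..<N + 2])"
    unfolding insertion_order_def filter_concat map_map U_def comp_def batch ..
  ultimately show ?thesis by (simp add: total_insert_cost_def U_def del: upt_Suc)
qed


end

section \<open>Inputs as a configuration together with an order of the pairs\<close>

text \<open>\<open>\<rho>\<close> records in which order the pairs, numbered by increasing
  \<open>a\<close>, occur in the input. The recursive input is \<open>map v \<rho>\<close>, whose
  relative order depends on \<open>\<rho>\<close> alone because \<open>v\<close> increases on the
  \<open>a\<close>-positions.\<close>

definition decomposes :: "'a::linorder list \<Rightarrow> (nat \<Rightarrow> 'a) \<Rightarrow> nat list \<Rightarrow> bool" where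
  "decomposes xs v \<rho> \<longleftrightarrow>
    config (length xs div 2) (length xs - length xs div 2) v \<and>
    distinct \<rho> \<and> set \<rho> = {..<length xs div 2} \<and>
    pair_up xs = map (\<lambda>i. (v i, v (length xs div 2 + i))) \<rho> \<and>
    leftover xs = map v [2 * (length xs div 2)..<length xs]"

lemma mset_pair_up:
  "mset (map fst (pair_up xs)) + mset (map snd (pair_up xs)) + mset (leftover xs) = mset xs"
proof (induction xs rule: pair_up.induct)
  case (1 x y zs)
  have "leftover (x # y # zs) = leftover zs"
    by (cases zs) (auto simp: leftover_def)
  then show ?case using 1 by auto
qed (auto simp: leftover_def)

lemma pair_up_less: "distinct xs \<Longrightarrow> (a, b) \<in> set (pair_up xs) \<Longrightarrow> b < a"
  by (induction xs rule: pair_up.induct) (auto split: if_splits)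

lemma pair_up_props:
  assumes "distinct xs"
  shows "distinct (map fst (pair_up xs) @ map snd (pair_up xs) @ leftover xs)"
    "set (map fst (pair_up xs) @ map snd (pair_up xs) @ leftover xs) = set xs"
proof -
  have "mset (map fst (pair_up xs) @ map snd (pair_up xs) @ leftover xs) = mset xs"
    using mset_pair_up[of xs] by (simp add: add.assoc)
  then show "distinct (map fst (pair_up xs) @ map snd (pair_up xs) @ leftover xs)"
    "set (map fst (pair_up xs) @ map snd (pair_up xs) @ leftover xs) = set xs"
    using assms by (metis mset_eq_imp_distinct_iff, metis mset_eq_setD)
qed

lemma decomposes_exists:
  assumes "distinct xs"
  shows "\<exists>v \<rho>. decomposes xs v \<rho>"
proof -
  define m where "m = length xs div 2"
  define ps where "ps = pair_up xs"
  define as where "as = sorted_list_of_set (fst ` set ps)"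
  define partner where "partner a = the (map_of ps a)" for a
  define v where
    "v p = (if p < m then as ! p else if p < 2 * m then partner (as ! (p - m)) else last xs)" for p
  define \<rho> where "\<rho> = map (the_inv_into {..<m} v) (map fst ps)"
  have dist: "distinct (map fst ps @ map snd ps @ leftover xs)"
    using pair_up_props[OF assms] by (simp add: ps_def)
  then have dist_fst: "distinct (map fst ps)" and dist_snd: "inj_on snd (set ps)"
    by (auto simp: distinct_map)
  have len_ps: "length ps = m" by (simp add: ps_def m_def)
  have as: "set as = fst ` set ps" "sorted_wrt (<) as" "distinct as"
    by (simp_all add: as_def)
  have len_as: "length as = m"
    using distinct_card[OF as(3)] distinct_card[OF dist_fst] len_ps by (simp add: as(1))
  have partner: "partner (fst pr) = snd pr" if "pr \<in> set ps" for pr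
    using map_of_is_SomeI[OF dist_fst, of "fst pr" "snd pr"] that by (simp add: partner_def)
  have v_low: "v p = as ! p" if "p < m" for p using that by (simp add: v_def)
  have pair_in: "(v p, v (m + p)) \<in> set ps" if "p < m" for p
  proof -
    have "as ! p \<in> fst ` set ps" using that len_as as(1) by (metis nth_mem)
    then obtain pr where "pr \<in> set ps" "as ! p = fst pr" by auto
    then show ?thesis using that partner[of pr] by (simp add: v_def)
  qed
  have inj_low: "inj_on v {..<m}"
    using as(3) len_as by (auto simp: inj_on_def v_low nth_eq_iff_index_eq)
  have odd: "leftover xs = [last xs]" "length xs = 2 * m + 1" if "2 * m < length xs"
    using that by (auto simp: leftover_def m_def)
  have config: "config m (length xs - m) v"
  proof
    show "m \<le> length xs - m" by (simp add: m_def)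
    show "strict_mono_on {..<m} v"
      using as(2) len_as by (auto intro!: strict_mono_onI simp: v_low sorted_wrt_nth_less)
    show "v (m + i) < v i" if "i < m" for i
      using pair_up_less[OF assms] pair_in[OF that] by (simp add: ps_def)
    have "inj_on v ({..<m} \<union> {m..<2 * m} \<union> {2 * m..<length xs})"
    proof -
      have low: "v p \<in> fst ` set ps" if "p < m" for p
        using pair_in[OF that] by (force intro: rev_image_eqI)
      have mid: "v p \<in> snd ` set ps" if "m \<le> p" "p < 2 * m" for p
      proof -
        have "p - m < m" "m + (p - m) = p" using that by auto
        then show ?thesis using pair_in[of "p - m"] by (force intro: rev_image_eqI)
      qed
      have high: "v p \<in> set (leftover xs)" if "2 * m \<le> p" "p < length xs" for p
        using odd that by (auto simp: v_def)
      have "inj_on v {m..<2 * m}"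
      proof (rule inj_onI)
        fix p q assume pq: "p \<in> {m..<2 * m}" "q \<in> {m..<2 * m}" "v p = v q"
        then have "(v (p - m), v p) \<in> set ps" "(v (q - m), v q) \<in> set ps"
          using pair_in[of "p - m"] pair_in[of "q - m"] by auto
        then have "v (p - m) = v (q - m)" using inj_onD[OF dist_snd, of "(v (p - m), v p)" "(v (q - m), v q)"] pq(3) by simp
        then have "p - m = q - m" using pq by (intro inj_onD[OF inj_low]) auto
        then show "p = q" using pq by auto
      qed
      moreover have "inj_on v {2 * m..<length xs}"
        using odd by (cases "2 * m < length xs") (auto intro!: inj_onI)
      moreover have "v ` {..<m} \<subseteq> set (map fst ps)" "v ` {m..<2 * m} \<subseteq> set (map snd ps)"
        "v ` {2 * m..<length xs} \<subseteq> set (leftover xs)"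
        using low mid high by auto
      then have "v ` {..<m} \<inter> v ` {m..<2 * m} = {}"
        "(v ` {..<m} \<union> v ` {m..<2 * m}) \<inter> v ` {2 * m..<length xs} = {}"
        using dist unfolding distinct_append set_append by blast+
      moreover have "inj_on v (A \<union> B)" if "inj_on v A" "inj_on v B" "v ` A \<inter> v ` B = {}" for A B
        using that by (auto simp: inj_on_Un)
      ultimately show ?thesis
        using inj_low by (simp add: image_Un)
    qed
    moreover have "{..<m + (length xs - m)} \<subseteq> {..<m} \<union> {m..<2 * m} \<union> {2 * m..<length xs}"
      by (auto simp: m_def)
    ultimately show "inj_on v {..<m + (length xs - m)}" by (rule inj_on_subset)
  qed
  have img: "v ` {..<m} = fst ` set ps"
  proof -
    have "map v [0..<m] = as" by (rule nth_equalityI) (auto simp: len_as v_low)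
    then have "set (map v [0..<m]) = set as" by simp
    then show ?thesis by (simp add: as(1) lessThan_atLeast0)
  qed
  have inv: "the_inv_into {..<m} v (fst pr) < m" "v (the_inv_into {..<m} v (fst pr)) = fst pr"
    if "pr \<in> set ps" for pr
    using that the_inv_into_into[OF inj_low, of "fst pr" "{..<m}"]
      f_the_inv_into_f[OF inj_low, of "fst pr"] img by auto
  have "distinct \<rho>"
    using dist_fst inj_on_the_inv_into[OF inj_low] by (simp add: \<rho>_def distinct_map img comp_inj_on_iff)
  moreover have "set \<rho> = {..<m}"
    using the_inv_into_onto[OF inj_low] by (simp add: \<rho>_def img image_image)
  moreover have "map (\<lambda>i. (v i, v (m + i))) \<rho> = ps"
  proof -
    have "(v i, v (m + i)) = pr" if "pr \<in> set ps" "i = the_inv_into {..<m} v (fst pr)" for pr i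
    proof -
      have "i < m" "v i = fst pr" using inv[OF that(1)] that(2) by auto
      moreover from this have "v (m + i) = partner (v i)" by (simp add: v_def)
      ultimately show ?thesis using partner[OF that(1)] by (simp add: prod_eq_iff)
    qed
    then show ?thesis by (simp add: \<rho>_def comp_def map_idI)
  qed
  moreover have "leftover xs = map v [2 * m..<length xs]"
  proof (cases "2 * m < length xs")
    case True
    then show ?thesis using odd by (simp add: v_def)
  next
    case False
    then have "length xs = 2 * m" by (simp add: m_def)
    then show ?thesis by (simp add: leftover_def)
  qed
  ultimately show ?thesis
    using config unfolding decomposes_def m_def[symmetric] ps_def by metis
qed

lemma decomposes_set:
  assumes "decomposes xs v \<rho>"
  shows "set xs = v ` {..<length xs}"
proof -
  define m where "m = length xs div 2"
  have \<rho>: "set \<rho> = {..<m}" and ps: "pair_up xs = map (\<lambda>i. (v i, v (m + i))) \<rho>"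
    and left: "leftover xs = map v [2 * m..<length xs]"
    using assms unfolding decomposes_def m_def[symmetric] by auto
  have "set xs = set_mset (mset xs)" by simp
  also have "\<dots> = v ` {..<m} \<union> (\<lambda>i. v (m + i)) ` {..<m} \<union> v ` {2 * m..<length xs}"
    unfolding mset_pair_up[of xs, symmetric] ps left by (simp add: \<rho> image_image)
  also have "(\<lambda>i. v (m + i)) ` {..<m} = v ` {m..<2 * m}"
  proof -
    have "(\<lambda>i. v (m + i)) ` {..<m} = v ` ((+) m ` {0..<m})"
      by (simp only: image_image lessThan_atLeast0)
    then show ?thesis by (simp add: mult_2)
  qed
  also have "v ` {..<m} \<union> v ` {m..<2 * m} \<union> v ` {2 * m..<length xs} =
      v ` ({..<m} \<union> {m..<2 * m} \<union> {2 * m..<length xs})"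
    by (simp only: image_Un)
  also have "{..<m} \<union> {m..<2 * m} \<union> {2 * m..<length xs} = {..<length xs}"
    by (auto simp: m_def)
  finally show ?thesis .
qed

text \<open>Sortedness of the recursive result is assumed since the insertion phase must start from
  \<open>map v [0..<m]\<close>; the induction in \<open>merge_insertion_sorts\<close> discharges
  it.\<close>

lemma merge_insertion_step:
  assumes "decomposes xs v \<rho>" "2 \<le> length xs"
    and m: "m = length xs div 2" and N: "N = length xs - m"
    and rec: "fst (merge_insertion (map v \<rho>)) = sorted_list_of_set (set (map v \<rho>))"
  shows "fst (merge_insertion xs) = sorted_list_of_set (set xs)"
    "snd (merge_insertion xs) =
      m + snd (merge_insertion (map v \<rho>)) + total_insert_cost m N v"
proof -
  define ps where "ps = pair_up xs"
  have \<rho>: "distinct \<rho>" "set \<rho> = {..<m}" and ps: "ps = map (\<lambda>i. (v i, v (m + i))) \<rho>"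
    and left: "leftover xs = map v [2 * m..<length xs]" and config: "config m N v"
    using assms(1) unfolding decomposes_def m[symmetric] N[symmetric] ps_def by auto
  interpret config m N v by (rule config)
  have len: "length xs = m + N" "0 < m" "0 < N" using assms(2) by (auto simp: m N)
  have fst_ps: "map fst ps = map v \<rho>" by (simp add: ps)
  have v_less: "v i < v j" if "i < j" "j < m" for i j
    using mono that by (auto simp: strict_mono_on_def)
  have as: "sorted_list_of_set (set (map v \<rho>)) = map v [0..<m]"
    using strict_sorted_eq[of "map v [0..<m]"] v_less
    by (simp add: \<rho> sorted_wrt_iff_nth_less lessThan_atLeast0)
  obtain c where c: "merge_insertion (map v \<rho>) = (map v [0..<m], c)"
    using rec as by (metis prod.collapse)
  have "distinct (map fst ps)"
    using \<rho> inj by (auto simp: fst_ps distinct_map intro: inj_on_subset)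
  then have partner: "the (map_of ps (v i)) = v (m + i)" if "i < m" for i
  proof -
    have "(v i, v (m + i)) \<in> set ps" using that \<rho>(2) by (simp add: ps)
    then show ?thesis using map_of_is_SomeI \<open>distinct (map fst ps)\<close> by fastforce
  qed
  have "map (\<lambda>a. the (map_of ps a)) (map v [0..<m]) = map v [m..<2 * m]"
    by (rule nth_equalityI) (auto simp: partner)
  then have "map (\<lambda>a. the (map_of ps a)) (map v [0..<m]) @ leftover xs = map v ([m..<2 * m] @ [2 * m..<m + N])"
    by (simp add: left len(1))
  also have "[m..<2 * m] @ [2 * m..<m + N] = [m..<m + N]"
    using m_le_N upt_add_eq_append[of m "2 * m" "N - m"] by simp
  finally have bs: "map (\<lambda>a. the (map_of ps a)) (map v [0..<m]) @ leftover xs = map v [m..<m + N]" .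
  have "sorted_wrt (<) (v m # map v [0..<m])"
  proof -
    have "v m < v i" if "i < m" for i
      using pair_less[of 0] v_less[of 0 i] that len by (cases "i = 0") auto
    moreover have "sorted_wrt (<) (map v [0..<m])" using v_less by (auto simp: sorted_wrt_iff_nth_less)
    ultimately show ?thesis by auto
  qed
  then have "v m # map v [0..<m] = main_chain v {..<m + 1}"
  proof -
    assume "sorted_wrt (<) (v m # map v [0..<m])"
    moreover have "set (v m # map v [0..<m]) = v ` {..<m + 1}"
      by (auto simp: less_Suc_eq)
    ultimately show ?thesis unfolding main_chain_def by (metis strict_sorted_eq)
  qed
  moreover have "hd (map v [m..<m + N]) = v m" using len by (simp add: hd_map)
  ultimately have start: "hd (map v [m..<m + N]) # map v [0..<m] = main_chain v {..<m + 1}" by simp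
  have "merge_insertion xs = (main_chain v {..<m + N}, length ps + c + total_insert_cost m N v)"
  proof -
    define bs where "bs = map (\<lambda>a. the (map_of ps a)) (map v [0..<m]) @ leftover xs"
    have "merge_insertion xs =
      (case fold (insert_b (map v [0..<m]) bs) (insertion_order (length bs)) (hd bs # map v [0..<m], 0) of
        (ch, c2) \<Rightarrow> (ch, length ps + c + c2))"
      using assms(2)
      by (subst merge_insertion.simps) (simp add: Let_def ps_def[symmetric] fst_ps c bs_def)
    moreover have "bs = map v [m..<m + N]" using bs by (simp only: bs_def)
    ultimately show ?thesis
      using fold_insertion_order[OF len(3)] start by (simp del: upt_Suc)
  qed
  moreover have "length ps = m" by (simp add: ps_def m)
  moreover have "set xs = v ` {..<m + N}" using decomposes_set[OF assms(1)] by (simp add: len(1))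
  ultimately show "fst (merge_insertion xs) = sorted_list_of_set (set xs)"
    "snd (merge_insertion xs) = m + snd (merge_insertion (map v \<rho>)) + total_insert_cost m N v"
    by (simp_all add: main_chain_def c)
qed

lemma decomposes_distinct:
  assumes "decomposes xs v \<rho>"
  shows "distinct (map v \<rho>)" "length \<rho> = length xs div 2"
proof -
  define m where "m = length xs div 2"
  have "config m (length xs - m) v" "distinct \<rho>" "set \<rho> = {..<m}"
    using assms by (auto simp: decomposes_def m_def)
  then show "distinct (map v \<rho>)" "length \<rho> = m"
    using distinct_card[of \<rho>] by (auto simp: distinct_map config_def intro: inj_on_subset)
qed

lemma merge_insertion_sorts:
  "distinct xs \<Longrightarrow> fst (merge_insertion xs) = sorted_list_of_set (set xs)"
proof (induction "length xs" arbitrary: xs rule: less_induct)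
  case less
  show ?case
  proof (cases "length xs < 2")
    case True
    then show ?thesis
      by (subst merge_insertion.simps) (auto simp: less_2_cases_iff length_Suc_conv)
  next
    case False
    obtain v \<rho> where d: "decomposes xs v \<rho>" using decomposes_exists[OF less.prems] by blast
    have "fst (merge_insertion (map v \<rho>)) = sorted_list_of_set (set (map v \<rho>))"
      using False decomposes_distinct[OF d] by (intro less.hyps) auto
    then show ?thesis using merge_insertion_step(1)[OF d _ refl refl] False by simp
  qed
qed

lemma snd_merge_insertion:
  assumes "decomposes xs v \<rho>" "2 \<le> length xs"
    and m: "m = length xs div 2" and N: "N = length xs - m"
  shows "snd (merge_insertion xs) =
    m + snd (merge_insertion (map v \<rho>)) + total_insert_cost m N v"
  using merge_insertion_step(2)[OF assms] merge_insertion_sorts decomposes_distinct[OF assms(1)]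
  by blast


section \<open>Invariance under relabelling of the values\<close>

lemma total_insert_cost_cong:
  assumes v: "config m N v" and w: "config m N w"
    and less: "\<And>p q. p < m + N \<Longrightarrow> q < m + N \<Longrightarrow> w p < w q \<longleftrightarrow> v p < v q"
  shows "total_insert_cost m N w = total_insert_cost m N v"
proof -
  have rank: "rank P w p = rank P v p" if "P \<subseteq> {..<m + N}" "p < m + N" for P p
  proof -
    have "{q \<in> P. w q < w p} = {q \<in> P. v q < v p}" using less that by (auto simp: subset_iff)
    then show ?thesis by (simp add: rank_def)
  qed
  have step: "step_cost m w P j = step_cost m v P j" if "P \<subseteq> {..<m + N}" "j < N" for P j
    using that rank by (simp add: step_cost_def chain_len_def)
  show ?thesis
    unfolding total_insert_cost_def batch_cost_def
    by (intro sum.cong refl step) (auto simp: present_def)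
qed

lemma pair_up_map:
  "distinct xs \<Longrightarrow> (\<And>a b. (a, b) \<in> set (pair_up xs) \<Longrightarrow> f b < f a) \<Longrightarrow>
    pair_up (map f xs) = map (map_prod f f) (pair_up xs)"
proof (induction xs rule: pair_up.induct)
  case (1 x y zs)
  have "pair_up (map f zs) = map (map_prod f f) (pair_up zs)"
    using 1 by simp
  moreover have "x < y \<Longrightarrow> f x < f y" "\<not> x < y \<Longrightarrow> f y < f x"
    using 1(2,3) by (auto split: if_splits)
  ultimately show ?case by (auto dest: less_asym)
qed auto

lemma leftover_map: "leftover (map f xs) = map f (leftover xs)"
  by (cases "xs = []") (auto simp: leftover_def last_map)

text \<open>\<open>pair_up\<close> compares only the two members of a pair, so it suffices that
  \<open>w\<close> respects these. The identity as \<open>\<sigma>\<close> covers order-preserving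
  relabellings; a general \<open>\<sigma>\<close> moves one configuration and pair order to
  another.\<close>

lemma decomposes_map:
  assumes d: "decomposes xs v \<rho>" and dist: "distinct xs" and m: "m = length xs div 2"
    and v': "config m (length xs - m) v'"
    and \<sigma>: "inj_on \<sigma> {..<m}" "\<sigma> ` {..<m} = {..<m}"
    and w: "\<And>i. i < m \<Longrightarrow> w (v i) = v' (\<sigma> i)" "\<And>i. i < m \<Longrightarrow> w (v (m + i)) = v' (m + \<sigma> i)"
      "\<And>i. 2 * m \<le> i \<Longrightarrow> i < length xs \<Longrightarrow> w (v i) = v' i"
  shows "decomposes (map w xs) v' (map \<sigma> \<rho>)"
proof -
  have \<rho>: "distinct \<rho>" "set \<rho> = {..<m}" and ps: "pair_up xs = map (\<lambda>i. (v i, v (m + i))) \<rho>"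
    and left: "leftover xs = map v [2 * m..<length xs]"
    using d unfolding decomposes_def m[symmetric] by auto
  have "pair_up (map w xs) = map (map_prod w w) (pair_up xs)"
  proof (rule pair_up_map[OF dist])
    fix a b assume "(a, b) \<in> set (pair_up xs)"
    then obtain i where "i < m" "a = v i" "b = v (m + i)" using \<rho>(2) by (auto simp: ps)
    moreover have "\<sigma> i < m" using \<sigma>(2) \<open>i < m\<close> by blast
    ultimately show "w b < w a" using w config.pair_less[OF v'] by simp
  qed
  also have "\<dots> = map (\<lambda>i. (v' i, v' (m + i))) (map \<sigma> \<rho>)"
    using \<rho>(2) w by (simp add: ps)
  finally have "pair_up (map w xs) = map (\<lambda>i. (v' i, v' (m + i))) (map \<sigma> \<rho>)" .
  moreover have "leftover (map w xs) = map v' [2 * m..<length xs]"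
    using w(3) by (simp add: leftover_map left)
  moreover have "distinct (map \<sigma> \<rho>)" "set (map \<sigma> \<rho>) = {..<m}"
    using \<rho> \<sigma> by (auto simp: distinct_map)
  ultimately show ?thesis using v' by (simp add: decomposes_def m[symmetric])
qed

text \<open>Bridges the recursive call, which receives the values \<open>map v \<rho>\<close>, and
  \<open>avg_comparisons m\<close>, which averages over permutations of
  \<open>{..<m}\<close>.\<close>

lemma snd_merge_insertion_map:
  "distinct xs \<Longrightarrow> strict_mono_on (set xs) f \<Longrightarrow>
    snd (merge_insertion (map f xs)) = snd (merge_insertion xs)"
proof (induction "length xs" arbitrary: xs rule: less_induct)
  case less
  show ?case
  proof (cases "length xs < 2")
    case True
    then show ?thesis by (subst (1 2) merge_insertion.simps) simp
  next
    case False
    define m N where "m = length xs div 2" and "N = length xs - m"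
    obtain v \<rho> where d: "decomposes xs v \<rho>" using decomposes_exists[OF less.prems(1)] by blast
    have v: "config m N v" and \<rho>: "set \<rho> = {..<m}"
      using d unfolding decomposes_def m_def[symmetric] N_def[symmetric] by auto
    have len: "length xs = m + N" by (simp add: N_def m_def)
    have set: "v ` {..<m + N} = set xs" using decomposes_set[OF d] by (simp add: len)
    have f: "f (v p) < f (v q) \<longleftrightarrow> v p < v q" if "p < m + N" "q < m + N" for p q
      using strict_mono_on_less[OF less.prems(2)] that set by blast
    have fv: "config m N (f \<circ> v)"
    proof
      show "strict_mono_on {..<m} (f \<circ> v)"
        using config.mono[OF v] f by (auto simp: strict_mono_on_def)
      show "inj_on (f \<circ> v) {..<m + N}"
        using config.inj[OF v] strict_mono_on_imp_inj_on[OF less.prems(2)] set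
        by (intro comp_inj_on) auto
      show "(f \<circ> v) (m + i) < (f \<circ> v) i" if "i < m" for i
        using f[of "m + i" i] config.pair_less[OF v that] config.m_le_N[OF v] that by simp
    qed (rule config.m_le_N[OF v])
    have "decomposes (map f xs) (f \<circ> v) (map id \<rho>)"
      using fv by (intro decomposes_map[OF d less.prems(1) m_def]) (auto simp: N_def)
    then have d': "decomposes (map f xs) (f \<circ> v) \<rho>" by simp
    have sub: "set (map v \<rho>) \<subseteq> set xs" using set \<rho> by auto
    have "snd (merge_insertion (map f xs)) =
        m + snd (merge_insertion (map (f \<circ> v) \<rho>)) + total_insert_cost m N (f \<circ> v)"
      using False by (intro snd_merge_insertion[OF d']) (auto simp: m_def N_def)
    also have "map (f \<circ> v) \<rho> = map f (map v \<rho>)" by simp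
    also have "snd (merge_insertion \<dots>) = snd (merge_insertion (map v \<rho>))"
      using False decomposes_distinct[OF d] monotone_on_subset[OF less.prems(2) sub]
      by (intro less.hyps) auto
    also have "total_insert_cost m N (f \<circ> v) = total_insert_cost m N v"
      using f by (intro total_insert_cost_cong[OF v fv]) simp
    also have "m + snd (merge_insertion (map v \<rho>)) + total_insert_cost m N v =
        snd (merge_insertion xs)"
      using False by (intro snd_merge_insertion[OF d, symmetric]) (auto simp: m_def N_def)
    finally show ?thesis .
  qed
qed

section \<open>Averaging over input permutations\<close>

lemma config_if_configs:
  assumes "v \<in> configs m N" "m \<le> N"
  shows "config m N v"
  using assms by unfold_locales (auto simp: configs_def dest: permutes_inj_on)

lemma decomposes_unique:
  assumes "decomposes xs v \<rho>" "decomposes xs w \<pi>" "p < length xs"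
  shows "v p = w p" "\<rho> = \<pi>"
proof -
  define m N where "m = length xs div 2" and "N = length xs - m"
  have v: "config m N v" "distinct \<rho>" "set \<rho> = {..<m}"
    "pair_up xs = map (\<lambda>i. (v i, v (m + i))) \<rho>" "leftover xs = map v [2 * m..<length xs]"
    and w: "config m N w" "distinct \<pi>" "set \<pi> = {..<m}"
    "pair_up xs = map (\<lambda>i. (w i, w (m + i))) \<pi>" "leftover xs = map w [2 * m..<length xs]"
    using assms(1,2) unfolding decomposes_def m_def[symmetric] N_def[symmetric] by auto
  have sorted: "map u [0..<m] = sorted_list_of_set (u ` {..<m})" if "config m N u" for u
  proof -
    have "sorted_wrt (<) (map u [0..<m])"
      using config.mono[OF that] by (auto simp: sorted_wrt_iff_nth_less strict_mono_on_def)
    from strict_sorted_eq[OF this] show ?thesis by (simp add: lessThan_atLeast0)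
  qed
  have fst_eq: "map v \<rho> = map w \<pi>"
    using arg_cong[OF v(4), of "map fst"] arg_cong[OF w(4), of "map fst"] by (simp add: comp_def)
  then have "set (map v \<rho>) = set (map w \<pi>)" by (rule arg_cong)
  then have "map v [0..<m] = map w [0..<m]"
    using sorted[OF v(1)] sorted[OF w(1)] v(3) w(3) by simp
  then have low: "v i = w i" if "i < m" for i using that by (simp add: map_eq_conv)
  have injv: "inj_on v {..<m}" by (rule inj_on_subset[OF config.inj[OF v(1)]]) auto
  have "map v \<rho> = map v \<pi>" using fst_eq low w(3) by (metis (mono_tags, lifting) lessThan_iff map_cong)
  then show \<rho>\<pi>: "\<rho> = \<pi>"
    using injv v(3) w(3) by (intro map_inj_on[of v]) auto
  have mid: "v (m + i) = w (m + i)" if "i < m" for i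
  proof -
    have "map (\<lambda>i. (v i, v (m + i))) \<rho> = map (\<lambda>i. (w i, w (m + i))) \<rho>"
      using v(4) w(4) \<rho>\<pi> by simp
    then show ?thesis using that v(3) by (auto simp: map_eq_conv)
  qed
  have high: "v i = w i" if "2 * m \<le> i" "i < length xs" for i
    using v(5) w(5) that by (auto simp: map_eq_conv)
  consider "p < m" | "m \<le> p" "p < 2 * m" | "2 * m \<le> p" by linarith
  then show "v p = w p"
  proof cases
    case 2
    then show ?thesis using mid[of "p - m"] by simp
  qed (use low high assms(3) in auto)
qed

lemma decomposes_configs:
  assumes "xs \<in> permutations_of_set {..<n}" "m = n div 2" "N = n - m"
  shows "\<exists>!y. y \<in> configs m N \<times> permutations_of_set {..<m} \<and> decomposes xs (fst y) (snd y)"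
proof -
  have dist: "distinct xs" and set: "set xs = {..<n}" and len: "length xs = n"
    using assms(1) length_finite_permutations_of_set[OF assms(1)]
    by (auto simp: permutations_of_set_def)
  have n: "m + N = n" using assms(2,3) by simp
  obtain v \<rho> where d: "decomposes xs v \<rho>" using decomposes_exists[OF dist] by blast
  \<comment> \<open>\<open>configs\<close> asks for a permutation of all naturals; extending by the
    identity also makes the configuration unique as a function.\<close>
  define v' where "v' p = (if p < n then v p else p)" for p
  have img: "v ` {..<n} = {..<n}" using decomposes_set[OF d] set len by simp
  have v: "config m N v"
    using d unfolding decomposes_def len assms(2)[symmetric] assms(3)[symmetric] by blast
  have "v' permutes {..<n}"
  proof (rule bij_imp_permutes)
    have "bij_betw v {..<n} {..<n}" using img config.inj[OF v] n by (simp add: bij_betw_def)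
    then show "bij_betw v' {..<n} {..<n}"
      by (rule bij_betw_cong[THEN iffD1, rotated]) (simp add: v'_def)
  qed (simp add: v'_def)
  moreover have le: "m \<le> N" by (rule config.m_le_N[OF v])
  ultimately have v': "v' \<in> configs m N"
    using config.mono[OF v] config.pair_less[OF v] n
    by (auto simp: configs_def v'_def strict_mono_on_def)
  have "decomposes (map id xs) v' (map id \<rho>)"
    using config_if_configs[OF v' le] len assms(2,3)
    by (intro decomposes_map[OF d dist]) (auto simp: v'_def)
  then have d': "decomposes xs v' \<rho>" by simp
  have \<rho>: "\<rho> \<in> permutations_of_set {..<m}"
    using d unfolding decomposes_def len assms(2)[symmetric] by (simp add: permutations_of_set_def)
  show ?thesis
  proof (rule ex1I[of _ "(v', \<rho>)"], goal_cases)
    case 1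
    then show ?case using v' \<rho> d' by simp
  next
    case (2 pr)
    then obtain w \<pi> where w: "pr = (w, \<pi>)" "w \<in> configs m N" "decomposes xs w \<pi>"
      by (cases pr) auto
    have "w p = v' p" for p
    proof (cases "p < n")
      case True
      then show ?thesis using decomposes_unique(1)[OF w(3) d'] len by simp
    next
      case False
      then have "p \<notin> {..<m + N}" using n by simp
      moreover
      have "w permutes {..<m + N}" "v' permutes {..<m + N}"
        using w(2) v' by (auto simp: configs_def)
      ultimately show ?thesis by (metis permutes_not_in)
    qed
    moreover have "\<pi> = \<rho>"
    proof (cases "xs = []")
      case True
      then have "m = 0" using len assms(2) by simp
      then show ?thesis using w(3) d' True by (simp add: decomposes_def)
    next
      case False
      then show ?thesis using decomposes_unique(2)[OF w(3) d', of 0] by simp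
    qed
    ultimately show ?case using w(1) by auto
  qed
qed

text \<open>Relabelling the values moves any fibre into any other, so all fibres have the same size.\<close>
lemma card_decomposes_le:
  assumes m: "m = n div 2" "N = n - m"
    and v: "v \<in> configs m N" "\<rho> \<in> permutations_of_set {..<m}"
    and v': "v' \<in> configs m N" "\<rho>' \<in> permutations_of_set {..<m}"
  shows "card {xs \<in> permutations_of_set {..<n}. decomposes xs v \<rho>} \<le>
    card {xs \<in> permutations_of_set {..<n}. decomposes xs v' \<rho>'}"
proof -
  have n: "m + N = n" "m \<le> N" using m by auto
  have \<rho>: "distinct \<rho>" "set \<rho> = {..<m}" "length \<rho> = m"
    and \<rho>': "distinct \<rho>'" "set \<rho>' = {..<m}" "length \<rho>' = m"
    using v(2) v'(2) by (auto simp: permutations_of_set_def distinct_card[symmetric])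
  define \<sigma> where "\<sigma> = (!) \<rho>' \<circ> the_inv_into {..<m} ((!) \<rho>)"
  have nth: "bij_betw ((!) \<rho>) {..<m} {..<m}" "bij_betw ((!) \<rho>') {..<m} {..<m}"
    by (intro bij_betw_nth; simp add: \<rho> \<rho>')+
  have \<sigma>: "bij_betw \<sigma> {..<m} {..<m}"
    unfolding \<sigma>_def using bij_betw_the_inv_into[OF nth(1)] nth(2) by (rule bij_betw_trans)
  have map_\<sigma>: "map \<sigma> \<rho> = \<rho>'"
    using the_inv_into_f_f[OF bij_betw_imp_inj_on[OF nth(1)]] \<rho>(3) \<rho>'(3)
    by (intro nth_equalityI) (auto simp: \<sigma>_def)
  have perm: "v permutes {..<n}" using v(1) n by (auto simp: configs_def)
  \<comment> \<open>Both positions of pair \<open>i\<close> move to those of pair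
    \<open>\<sigma> i\<close>, a leftover position stays. The relabelling \<open>w\<close> then
    carries the value at \<open>p\<close> to the value of \<open>v'\<close> at
    \<open>\<tau> p\<close>.\<close>
  define \<tau> where "\<tau> p = (if p < m then \<sigma> p else if p < 2 * m then m + \<sigma> (p - m) else p)" for p
  define w where "w = v' \<circ> \<tau> \<circ> inv v"
  have w: "w (v p) = v' (\<tau> p)" for p
    using perm by (simp add: w_def permutes_inverses)
  have img: "decomposes (map w xs) v' \<rho>'"
    if "xs \<in> permutations_of_set {..<n}" "decomposes xs v \<rho>" for xs
  proof -
    have xs: "distinct xs" "length xs = n"
      using that(1) length_finite_permutations_of_set[OF that(1)]
      by (auto simp: permutations_of_set_def)
    have "decomposes (map w xs) v' (map \<sigma> \<rho>)"
    proof (rule decomposes_map[OF that(2) xs(1)])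
      show "config m (length xs - m) v'" using config_if_configs[OF v'(1) n(2)] m xs(2) by simp
    qed (use \<sigma> w xs m in \<open>auto simp: \<tau>_def bij_betw_def\<close>)
    then show ?thesis by (simp add: map_\<sigma>)
  qed
  have set: "w ` {..<n} = {..<n}" "map w xs \<in> permutations_of_set {..<n}"
    if "xs \<in> permutations_of_set {..<n}" "decomposes xs v \<rho>" for xs
  proof -
    have xs: "set xs = {..<n}" "length xs = n"
      using that(1) length_finite_permutations_of_set[OF that(1)]
      by (auto simp: permutations_of_set_def)
    have s: "set (map w xs) = {..<n}"
      using decomposes_set[OF img[OF that]] v'(1) n xs
      by (simp add: configs_def permutes_image)
    then show "w ` {..<n} = {..<n}" using xs by simp
    show "map w xs \<in> permutations_of_set {..<n}"
      using s xs by (simp add: permutations_of_set_def card_distinct)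
  qed
  show ?thesis
  proof (cases "{xs \<in> permutations_of_set {..<n}. decomposes xs v \<rho>} = {}")
    case False
    then have "w ` {..<n} = {..<n}" using set by blast
    then have inj: "inj_on w {..<n}" by (intro eq_card_imp_inj_on) auto
    have "inj_on (map w) {xs \<in> permutations_of_set {..<n}. decomposes xs v \<rho>}"
      by (rule inj_on_mapI[OF inj_on_subset[OF inj]]) (auto simp: permutations_of_set_def)
    then show ?thesis
      using img set by (intro card_inj_on_le[where f = "map w"]) auto
  next
    case True
    then show ?thesis by (simp only: card.empty)
  qed
qed

text \<open>Equal fibre sizes make the configuration and the pair order independent and uniform, so
  the recursive cost averages over \<open>\<rho>\<close> and the insertion cost over
  \<open>v\<close>.\<close>

lemma avg_comparisons_rec:
  assumes "2 \<le> n" and m: "m = n div 2" "N = n - m"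
  shows "configs m N \<noteq> {}"
    "avg_comparisons n = m + avg_comparisons m +
      (\<Sum>v\<in>configs m N. real (total_insert_cost m N v)) / card (configs m N)"
proof -
  define X where "X = permutations_of_set {..<n}"
  define Y where "Y = configs m N \<times> permutations_of_set {..<m}"
  define F where "F y = {xs \<in> X. decomposes xs (fst y) (snd y)}" for y
  define cost :: "(nat \<Rightarrow> nat) \<times> nat list \<Rightarrow> real" where
    "cost y = m + real (snd (merge_insertion (snd y))) + real (total_insert_cost m N (fst y))" for y
  have fin: "finite X" "finite Y" "finite (F y)" for y by (auto simp: X_def Y_def F_def)
  have ex1: "\<exists>!y. y \<in> Y \<and> xs \<in> F y" if "xs \<in> X" for xs
    using decomposes_configs[OF that[unfolded X_def] m] that
    by (simp add: Y_def F_def)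
  have X: "X = (\<Union>y\<in>Y. F y)"
  proof (intro subset_antisym subsetI)
    fix xs assume "xs \<in> X"
    from ex1[OF this] show "xs \<in> (\<Union>y\<in>Y. F y)" by blast
  qed (auto simp: F_def)
  have disj: "\<forall>y\<in>Y. \<forall>z\<in>Y. y \<noteq> z \<longrightarrow> F y \<inter> F z = {}" using ex1 X by blast
  have "card X \<noteq> 0" by (simp add: X_def card_permutations_of_set)
  then have "X \<noteq> {}" by auto
  then have "Y \<noteq> {}" using X by auto
  then obtain y0 where y0: "y0 \<in> Y" by blast
  define K where "K = card (F y0)"
  have K: "card (F y) = K" if "y \<in> Y" for y
    using that y0 card_decomposes_le[OF m] unfolding K_def F_def X_def Y_def
    by (intro antisym) auto
  show "configs m N \<noteq> {}" using y0 by (auto simp: Y_def)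
  have cost: "real (snd (merge_insertion xs)) = cost y" if y: "y \<in> Y" "xs \<in> F y" for xs y
  proof -
    have xs: "length xs = n" using y(2) by (auto simp: F_def X_def dest: length_finite_permutations_of_set)
    have d: "decomposes xs (fst y) (snd y)" using y(2) by (simp add: F_def)
    have "config m N (fst y)" using config_if_configs[of "fst y" m N] y(1) m by (auto simp: Y_def)
    then have "strict_mono_on (set (snd y)) (fst y)" "distinct (snd y)"
      using y(1) config.mono by (auto simp: Y_def permutations_of_set_def)
    then have "snd (merge_insertion (map (fst y) (snd y))) = snd (merge_insertion (snd y))"
      by (rule snd_merge_insertion_map[rotated])
    then show ?thesis
      using snd_merge_insertion[OF d] xs assms by (simp add: cost_def)
  qed
  have "card X = K * card Y"
    unfolding X using fin disj K by (subst card_UN_disjoint) auto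
  then have fact: "fact n = real K * real (card Y)"
    by (metis X_def card_lessThan card_permutations_of_set finite_lessThan of_nat_fact of_nat_mult)
  have "(\<Sum>xs\<in>X. real (snd (merge_insertion xs))) = (\<Sum>y\<in>Y. \<Sum>xs\<in>F y. real (snd (merge_insertion xs)))"
    unfolding X by (rule sum.UNION_disjoint) (use fin disj in auto)
  also have "\<dots> = (\<Sum>y\<in>Y. real K * cost y)"
    using cost K by (intro sum.cong) auto
  also have "\<dots> = real K * (\<Sum>y\<in>Y. cost y)" by (rule sum_distrib_left[symmetric])
  finally have "avg_comparisons n = real K * (\<Sum>y\<in>Y. cost y) / (real K * real (card Y))"
    unfolding avg_comparisons_def X_def[symmetric] fact by simp
  also have "\<dots> = (\<Sum>y\<in>Y. cost y) / real (card Y)"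
  proof -
    have "real K \<noteq> 0" using fact fact_nonzero[of n, where 'a = real] by auto
    then show ?thesis by simp
  qed
  also have "(\<Sum>y\<in>Y. cost y) = real (card (configs m N)) * fact m * m +
      real (card (configs m N)) * (\<Sum>\<rho>\<in>permutations_of_set {..<m}. real (snd (merge_insertion \<rho>))) +
      fact m * (\<Sum>v\<in>configs m N. real (total_insert_cost m N v))"
    unfolding Y_def sum.cartesian_product'
    by (simp add: cost_def sum.distrib card_permutations_of_set sum_distrib_left[symmetric] distrib_left)
  also have "\<dots> / real (card Y) = m + avg_comparisons m +
      (\<Sum>v\<in>configs m N. real (total_insert_cost m N v)) / card (configs m N)"
  proof -
    have "real (card Y) = real (card (configs m N)) * fact m"
      by (simp add: Y_def card_cartesian_product card_permutations_of_set)
    moreover have "real (card (configs m N)) \<noteq> 0" using \<open>configs m N \<noteq> {}\<close> by simp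
    ultimately show ?thesis
      unfolding avg_comparisons_def by (simp add: field_simps)
  qed
  finally show "avg_comparisons n = m + avg_comparisons m +
      (\<Sum>v\<in>configs m N. real (total_insert_cost m N v)) / card (configs m N)" .
qed

section \<open>Average insertion cost\<close>

text \<open>Saving guaranteed in a complete batch: the summand is the bound of
  \<open>prob_b_above_a\<close> for \<open>b\<^sub>l\<close> above \<open>a\<^sub>j\<close>, and
  each such event is worth \<open>1 / 2 ^ k\<close>.\<close>

definition saving :: "nat \<Rightarrow> real" where
  "saving k = (\<Sum>j=batch_end (k - 1)..<batch_end k. \<Sum>l\<in>{j<..<batch_end k}.
    real (l - j) / real (2 * l + 1)) / 2 ^ k"

context
  fixes m N :: nat
  assumes mN: "m \<le> N" "N \<le> Suc m"
begin

text \<open>Below \<open>a\<^sub>j\<close> there are \<open>j\<close> elements \<open>a\<close>, at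
  most \<open>u\<close> elements \<open>b\<close> of earlier batches, and those of the
  \<open>w - Suc j\<close> already inserted \<open>b\<close> of this batch that are not above
  \<open>a\<^sub>j\<close>. An unpaired \<open>b\<^sub>j\<close> has \<open>w = Suc j\<close>, and
  its chain has \<open>m + u\<close> elements.\<close>

lemma chain_len_upper:
  assumes v: "v \<in> configs m N" and j: "u \<le> j" "j < w" "w \<le> N"
  shows "Suc (chain_len m (present m u w j) j v) + card {l \<in> {j<..<w}. v j < v (m + l)} \<le> u + w"
proof (cases "j < m")
  case True
  have mono: "strict_mono_on {..<m} v" using v by (auto simp: configs_def)
  have a: "v q < v j \<longleftrightarrow> q < j" if "q < m" for q
    using strict_mono_on_less[OF mono] that True by simp
  define A where "A = {l \<in> {j<..<w}. v j < v (m + l)}"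
  have sub: "{q \<in> present m u w j. v q < v j} \<subseteq> {..<j} \<union> {m..<m + u} \<union> (+) m ` ({j<..<w} - A)"
  proof
    fix q assume q: "q \<in> {q \<in> present m u w j. v q < v j}"
    consider "q < m" | "m \<le> q" "q < m + u" | "m + Suc j \<le> q" "q < m + w" using q by (force simp: present_def)
    then show "q \<in> {..<j} \<union> {m..<m + u} \<union> (+) m ` ({j<..<w} - A)"
    proof cases
      case 1
      then show ?thesis using q a by simp
    next
      case 3
      then obtain l where l: "q = m + l" by (metis le_add1 le_trans nat_le_iff_add)
      then have "l \<in> {j<..<w} - A" using 3 q by (auto simp: A_def)
      then show ?thesis using l by blast
    qed simp
  qed
  have "card ((+) m ` ({j<..<w} - A)) = card {j<..<w} - card A"
  proof (subst card_image)
    show "card ({j<..<w} - A) = card {j<..<w} - card A"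
      by (rule card_Diff_subset) (auto simp: A_def)
  qed simp
  moreover have "card A \<le> card {j<..<w}" unfolding A_def by (intro card_mono) auto
  moreover have "rank (present m u w j) v j \<le> card ({..<j} \<union> {m..<m + u} \<union> (+) m ` ({j<..<w} - A))"
    unfolding rank_def using sub by (rule card_mono[rotated]) (auto simp: present_def)
  moreover have "card ({..<j} \<union> {m..<m + u} \<union> (+) m ` ({j<..<w} - A)) \<le>
      j + u + card ((+) m ` ({j<..<w} - A))"
    using card_Un_le[of "{..<j} \<union> {m..<m + u}" "(+) m ` ({j<..<w} - A)"]
      card_Un_le[of "{..<j}" "{m..<m + u}"] by simp
  ultimately show ?thesis using True j by (simp add: chain_len_def A_def)
next
  case False
  then have "w = Suc j" "j = m" using j mN by auto
  then show ?thesis using False j by (simp add: chain_len_def present_def)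
qed

lemma chain_len_lower:
  assumes v: "v \<in> configs m N" and j: "u \<le> j" "j < w" "w \<le> N"
  shows "2 * u \<le> chain_len m (present m u w j) j v"
proof (cases "j < m")
  case True
  have mono: "v p < v q" if "p < q" "q < m" for p q
    using v that by (auto simp: configs_def strict_mono_on_def)
  have less: "v (m + l) < v l" if "l < m" for l using v that by (auto simp: configs_def)
  have "{..<u} \<union> (+) m ` {..<u} \<subseteq> {q \<in> present m u w j. v q < v j}"
  proof
    fix q assume "q \<in> {..<u} \<union> (+) m ` {..<u}"
    then consider "q < u" | l where "q = m + l" "l < u" by auto
    then show "q \<in> {q \<in> present m u w j. v q < v j}"
    proof cases
      case 1
      then show ?thesis using mono[of q j] True j by (simp add: present_def)
    next
      case 2
      then show ?thesis using less[of l] mono[of l j] True j by (simp add: present_def)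
    qed
  qed
  then have "card ({..<u} \<union> (+) m ` {..<u}) \<le> rank (present m u w j) v j"
    unfolding rank_def by (intro card_mono) (auto simp: present_def)
  moreover have "card ({..<u} \<union> (+) m ` {..<u}) = 2 * u"
    using True j by (subst card_Un_disjoint) (auto simp: card_image)
  ultimately show ?thesis using True by (simp add: chain_len_def)
next
  case False
  then have "w = Suc j" "j = m" using j mN by auto
  then show ?thesis using False j by (simp add: chain_len_def present_def)
qed

context
  fixes k u w :: nat
  assumes k: "2 \<le> k" and u: "u = batch_end (k - 1)" and w: "w \<le> batch_end k" "w \<le> N"
begin

text \<open>With the two bounds on the chain length this puts \<open>Suc M\<close> between
  \<open>2 ^ (k - 1)\<close> and \<open>2 ^ k\<close>, so within the batch only the costs
  \<open>k - 1\<close> and \<open>k\<close> matter.\<close>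

lemma u_w_le: "u + w \<le> 2 ^ k" "2 ^ k \<le> 2 * Suc (2 * u)"
proof -
  obtain l where l: "k = Suc l" "1 \<le> l" using k by (cases k) auto
  then show "u + w \<le> 2 ^ k" using batch_end_Suc[of l] u w by simp
  have "(2::int) ^ l \<ge> 2" using l(2) power_increasing[of 1 l "2::int"] by simp
  then have "3 * int (2 ^ k) \<le> 3 * int (2 * Suc (2 * u))"
    using three_batch_end[of l] l u by (cases "even l") auto
  then show "2 ^ k \<le> 2 * Suc (2 * u)" by linarith
qed

lemma step_cost_le:
  assumes v: "v \<in> configs m N" and j: "u \<le> j" "j < w"
  defines "M \<equiv> chain_len m (present m u w j) j v"
  shows "real (step_cost m v (present m u w j) j) \<le>
    real k - of_bool (rank (present m u w j) v (m + j) < 2 ^ k - Suc M)"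
proof -
  obtain l where l: "k = Suc l" using k by (cases k) auto
  have lower: "2 * u \<le> M" unfolding M_def by (rule chain_len_lower[OF v j w(2)])
  have upper: "Suc M \<le> 2 ^ k"
    using chain_len_upper[OF v j w(2)] u_w_le(1) by (simp add: M_def)
  have "insert_cost M (rank (present m u w j) v (m + j)) \<le> l"
    if "rank (present m u w j) v (m + j) < 2 ^ k - Suc M"
    using that lower upper u_w_le(2) l by (intro insert_cost_less) auto
  moreover have "insert_cost M (rank (present m u w j) v (m + j)) \<le> k"
    using upper by (intro insert_cost_le) simp
  ultimately show ?thesis
    unfolding step_cost_def M_def[symmetric] l by auto
qed

lemma sum_step_cost_le:
  assumes j: "u \<le> j" "j < w"
  shows "(\<Sum>v\<in>configs m N. real (step_cost m v (present m u w j) j)) \<le>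
    (\<Sum>v\<in>configs m N. real k - (2 ^ k / real (Suc (chain_len m (present m u w j) j v)) - 1))"
proof -
  define P where "P = present m u w j"
  define d where "d M = 2 ^ k - Suc M" for M :: nat
  have P: "{..<m} \<subseteq> P" "P \<subseteq> {..<m + N}" "m + j \<notin> P" using j w by (auto simp: P_def present_def)
  have len: "Suc (chain_len m P j v) \<le> 2 ^ k" "2 ^ k \<le> 2 * Suc (chain_len m P j v)"
    if "v \<in> configs m N" for v
    using chain_len_upper[OF that j w(2)] chain_len_lower[OF that j w(2)] u_w_le
    by (auto simp: P_def)
  have "(\<Sum>v\<in>configs m N. 2 ^ k / real (Suc (chain_len m P j v)) - 1) =
    (\<Sum>v\<in>configs m N. real (d (chain_len m P j v)) / real (Suc (chain_len m P j v)))"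
  proof (rule sum.cong[OF refl])
    fix v assume "v \<in> configs m N"
    then show "2 ^ k / real (Suc (chain_len m P j v)) - 1 =
        real (d (chain_len m P j v)) / real (Suc (chain_len m P j v))"
      using len(1) by (simp add: d_def of_nat_diff diff_divide_distrib del: of_nat_Suc)
  qed
  also have "\<dots> \<le> (\<Sum>v\<in>configs m N. of_bool (rank P v (m + j) < d (chain_len m P j v)))"
  proof (rule sum_rank_less_ge[OF mN(1) _ P])
    show "d (chain_len m P j v) \<le> Suc (chain_len m P j v)" if "v \<in> configs m N" for v
      using len(2)[OF that] by (simp add: d_def)
  qed (use j w in simp)
  finally have "(\<Sum>v\<in>configs m N. real k - of_bool (rank P v (m + j) < d (chain_len m P j v))) \<le>
      (\<Sum>v\<in>configs m N. real k - (2 ^ k / real (Suc (chain_len m P j v)) - 1))"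
    by (simp only: sum_subtractf)
  moreover have "(\<Sum>v\<in>configs m N. real (step_cost m v P j)) \<le>
      (\<Sum>v\<in>configs m N. real k - of_bool (rank P v (m + j) < d (chain_len m P j v)))"
    using step_cost_le[OF _ j] by (intro sum_mono) (simp add: P_def d_def)
  ultimately show ?thesis by (simp add: P_def)
qed

lemma batch_cost_le_last:
  assumes "u \<le> w"
  shows "(\<Sum>v\<in>configs m N. real (batch_cost m v u w)) \<le>
    card (configs m N) * (real (w - u) * (k - (2 ^ k / (u + w) - 1)))"
proof -
  have "(\<Sum>v\<in>configs m N. real (batch_cost m v u w)) =
      (\<Sum>v\<in>configs m N. \<Sum>j=u..<w. real (step_cost m v (present m u w j) j))"
    by (simp add: batch_cost_def)
  also have "\<dots> = (\<Sum>j=u..<w. \<Sum>v\<in>configs m N. real (step_cost m v (present m u w j) j))"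
    by (rule sum.swap)
  also have "\<dots> \<le> (\<Sum>j=u..<w. card (configs m N) * (k - (2 ^ k / (u + w) - 1)))"
  proof (rule sum_mono)
    fix j assume "j \<in> {u..<w}"
    then have j: "u \<le> j" "j < w" by auto
    have "(\<Sum>v\<in>configs m N. real (step_cost m v (present m u w j) j)) \<le>
      (\<Sum>v\<in>configs m N. real k - (2 ^ k / real (Suc (chain_len m (present m u w j) j v)) - 1))"
      by (rule sum_step_cost_le[OF j])
    also have "\<dots> \<le> (\<Sum>v\<in>configs m N. k - (2 ^ k / (u + w) - 1))"
    proof (rule sum_mono)
      fix v assume v: "v \<in> configs m N"
      have "Suc (chain_len m (present m u w j) j v) \<le> u + w"
        using chain_len_upper[OF v j w(2)] by simp
      then have "real (Suc (chain_len m (present m u w j) j v)) \<le> real u + real w"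
        by (simp only: of_nat_add[symmetric] of_nat_le_iff)
      then have "2 ^ k / (real u + real w) \<le> 2 ^ k / real (Suc (chain_len m (present m u w j) j v))"
        by (intro divide_left_mono) auto
      then show "real k - (2 ^ k / real (Suc (chain_len m (present m u w j) j v)) - 1) \<le>
          k - (2 ^ k / (u + w) - 1)" by simp
    qed
    also have "\<dots> = card (configs m N) * (k - (2 ^ k / (u + w) - 1))" by simp
    finally show "(\<Sum>v\<in>configs m N. real (step_cost m v (present m u w j) j)) \<le>
      card (configs m N) * (k - (2 ^ k / (u + w) - 1))" .
  qed
  also have "\<dots> = card (configs m N) * (real (w - u) * (k - (2 ^ k / (u + w) - 1)))"
    by simp
  finally show ?thesis .
qed

lemma batch_cost_le_full:
  assumes "u \<le> w" and full: "w = batch_end k"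
  shows "(\<Sum>v\<in>configs m N. real (batch_cost m v u w)) \<le>
    card (configs m N) * (real k * real (w - u) -
      (\<Sum>j=u..<w. \<Sum>l\<in>{j<..<w}. real (l - j) / real (2 * l + 1)) / 2 ^ k)"
proof -
  have uw: "u + w = 2 ^ k" using batch_end_Suc[of "k - 1"] k u full by simp
  have "(\<Sum>v\<in>configs m N. real (batch_cost m v u w)) =
      (\<Sum>v\<in>configs m N. \<Sum>j=u..<w. real (step_cost m v (present m u w j) j))"
    by (simp add: batch_cost_def)
  also have "\<dots> = (\<Sum>j=u..<w. \<Sum>v\<in>configs m N. real (step_cost m v (present m u w j) j))"
    by (rule sum.swap)
  also have "\<dots> \<le> (\<Sum>j=u..<w. card (configs m N) *
      (real k - (\<Sum>l\<in>{j<..<w}. real (l - j) / real (2 * l + 1)) / 2 ^ k))"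
  proof (rule sum_mono)
    fix j assume "j \<in> {u..<w}"
    then have j: "u \<le> j" "j < w" by auto
    define c where "c v = card {l \<in> {j<..<w}. v j < v (m + l)}" for v :: "nat \<Rightarrow> nat"
    have "(\<Sum>v\<in>configs m N. real (step_cost m v (present m u w j) j)) \<le>
      (\<Sum>v\<in>configs m N. real k - (2 ^ k / real (Suc (chain_len m (present m u w j) j v)) - 1))"
      by (rule sum_step_cost_le[OF j])
    also have "\<dots> \<le> (\<Sum>v\<in>configs m N. real k - real (c v) / 2 ^ k)"
    proof (rule sum_mono)
      fix v assume v: "v \<in> configs m N"
      define M where "M = Suc (chain_len m (present m u w j) j v)"
      have "M + c v \<le> 2 ^ k"
        using chain_len_upper[OF v j w(2)] uw by (simp add: c_def M_def)
      then have "real (M + c v) \<le> real (2 ^ k)" by (simp only: of_nat_le_iff)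
      then have le: "real M + real (c v) \<le> 2 ^ k" by simp
      have M: "0 < real M" by (simp add: M_def)
      \<comment> \<open>\<open>M + c v \<le> 2 ^ k\<close> gives the saving
        \<open>2 ^ k / M - 1 \<ge> c v / M\<close>; weakening the denominator to
        \<open>2 ^ k\<close> makes the bound linear in \<open>c v\<close>, so that only its
        expectation is needed.\<close>
      have "real (c v) / 2 ^ k \<le> real (c v) / real M"
      proof (rule divide_left_mono)
        show "real M \<le> 2 ^ k" using le by linarith
      qed (use M in auto)
      also have "\<dots> \<le> 2 ^ k / real M - 1"
        using le M by (simp add: field_simps)
      finally show "real k - (2 ^ k / real (Suc (chain_len m (present m u w j) j v)) - 1) \<le>
          real k - real (c v) / 2 ^ k" by (simp add: M_def)
    qed
    also have "\<dots> = card (configs m N) * real k - (\<Sum>v\<in>configs m N. real (c v)) / 2 ^ k"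
      by (simp add: sum_subtractf sum_divide_distrib)
    also have "(\<Sum>v\<in>configs m N. real (c v)) =
        (\<Sum>v\<in>configs m N. \<Sum>l\<in>{j<..<w}. of_bool (v j < v (m + l)))"
      by (simp add: c_def sum_of_bool_eq Int_def)
    also have "\<dots> = (\<Sum>l\<in>{j<..<w}. \<Sum>v\<in>configs m N. of_bool (v j < v (m + l)))"
      by (rule sum.swap)
    also have "card (configs m N) * real k - \<dots> / 2 ^ k \<le> card (configs m N) * real k -
        (\<Sum>l\<in>{j<..<w}. card (configs m N) * (real (l - j) / real (2 * l + 1))) / 2 ^ k"
      using w mN by (intro diff_left_mono divide_right_mono sum_mono prob_b_above_a) auto
    also have "\<dots> = card (configs m N) *
      (real k - (\<Sum>l\<in>{j<..<w}. real (l - j) / real (2 * l + 1)) / 2 ^ k)"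
      by (simp only: sum_distrib_left[symmetric]) (simp add: right_diff_distrib)
    finally show "(\<Sum>v\<in>configs m N. real (step_cost m v (present m u w j) j)) \<le>
      card (configs m N) * (real k - (\<Sum>l\<in>{j<..<w}. real (l - j) / real (2 * l + 1)) / 2 ^ k)" .
  qed
  also have "\<dots> = card (configs m N) * (real k * real (w - u) -
      (\<Sum>j=u..<w. \<Sum>l\<in>{j<..<w}. real (l - j) / real (2 * l + 1)) / 2 ^ k)"
    by (simp add: sum_distrib_left[symmetric] sum_subtractf sum_divide_distrib[symmetric] mult.commute)
  finally show ?thesis .
qed

end

lemma avg_insert_cost_le:
  assumes q: "2 \<le> q" "batch_end (q - 1) \<le> N" "N \<le> batch_end q"
    and ne: "configs m N \<noteq> {}"
  shows "(\<Sum>v\<in>configs m N. real (total_insert_cost m N v)) / card (configs m N) \<le>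
    (\<Sum>k=2..<q. real k * real (batch_end k - batch_end (k - 1)) - saving k) +
    real (N - batch_end (q - 1)) * (q - (2 ^ q / (batch_end (q - 1) + N) - 1))"
proof -
  define U where "U k = min (batch_end k) N" for k
  define b where "b k = (\<Sum>v\<in>configs m N. real (batch_cost m v (U (k - 1)) (U k)))" for k
  define C where "C = real (card (configs m N))"
  have C: "C > 0" using ne by (simp add: C_def card_gt_0_iff)
  have empty: "b k = 0" if "N \<le> batch_end (k - 1)" for k
  proof -
    have "N \<le> batch_end k" using that batch_end_mono[of "k - 1" k] by simp
    then show ?thesis
      using that by (simp add: b_def U_def batch_cost_def)
  qed
  have "(\<Sum>v\<in>configs m N. real (total_insert_cost m N v)) =
      (\<Sum>v\<in>configs m N. \<Sum>k=2..<N + 2. real (batch_cost m v (U (k - 1)) (U k)))"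
    by (simp only: total_insert_cost_def U_def of_nat_sum)
  also have "\<dots> = (\<Sum>k=2..<N + 2. b k)" unfolding b_def by (rule sum.swap)
  \<comment> \<open>Neither \<open>N + 2\<close> nor \<open>q + 1\<close> is known to be the larger
    bound; the batches in which they differ are empty.\<close>
  also have "\<dots> = (\<Sum>k=2..<max (N + 2) (q + 1). b k)"
  proof (rule sum.mono_neutral_left)
    show "\<forall>k\<in>{2..<max (N + 2) (q + 1)} - {2..<N + 2}. b k = 0"
    proof
      fix k assume "k \<in> {2..<max (N + 2) (q + 1)} - {2..<N + 2}"
      then have "N + 1 \<le> k - 1" by auto
      then show "b k = 0" using batch_end_mono[of "N + 1" "k - 1"] batch_end_ge[of N] by (intro empty) simp
    qed
  qed auto
  also have "\<dots> = (\<Sum>k=2..<q + 1. b k)"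
  proof (rule sum.mono_neutral_right)
    show "\<forall>k\<in>{2..<max (N + 2) (q + 1)} - {2..<q + 1}. b k = 0"
    proof
      fix k assume "k \<in> {2..<max (N + 2) (q + 1)} - {2..<q + 1}"
      then have "q \<le> k - 1" by auto
      then show "b k = 0" using batch_end_mono[of q "k - 1"] q by (intro empty) simp
    qed
  qed auto
  also have "\<dots> = (\<Sum>k=2..<q. b k) + b q" using q by simp
  also have "\<dots> \<le> (\<Sum>k=2..<q. C * (real k * real (batch_end k - batch_end (k - 1)) - saving k)) +
      C * (real (N - batch_end (q - 1)) * (q - (2 ^ q / (batch_end (q - 1) + N) - 1)))"
  proof (intro add_mono sum_mono)
    fix k assume "k \<in> {2..<q}"
    then have k: "2 \<le> k" "k \<le> q - 1" by auto
    have le: "batch_end k \<le> N" "batch_end (k - 1) \<le> batch_end k"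
      using batch_end_mono[of k "q - 1"] batch_end_mono[of "k - 1" k] k q by auto
    then show "b k \<le> C * (real k * real (batch_end k - batch_end (k - 1)) - saving k)"
      using batch_cost_le_full[OF k(1) refl order_refl le(1) le(2) refl]
      by (simp add: b_def U_def C_def saving_def)
  next
    show "b q \<le> C * (real (N - batch_end (q - 1)) * (q - (2 ^ q / (batch_end (q - 1) + N) - 1)))"
      using batch_cost_le_last[OF q(1) refl q(3) order_refl q(2)] q
      by (simp add: b_def U_def C_def)
  qed
  also have "\<dots> = C * ((\<Sum>k=2..<q. real k * real (batch_end k - batch_end (k - 1)) - saving k) +
    real (N - batch_end (q - 1)) * (q - (2 ^ q / (batch_end (q - 1) + N) - 1)))"
    by (simp add: distrib_left sum_distrib_left)
  finally show ?thesis using C unfolding C_def[symmetric] by (simp add: divide_le_eq mult.commute)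
qed

end

section \<open>Numerical bounds on the constant\<close>

lemma ln2_bounds: "692 / 1000 \<le> ln (2::real)" "ln (2::real) \<le> 6945 / 10000"
  using ln_approx_bounds[of 2 3, simplified, simplified eval_nat_numeral, simplified]
  by (simp_all add: power_divide)

text \<open>At \<open>z = 1\<close> the right side equals \<open>12 / 5\<close> and its slope
  \<open>\<kappa> - 36 / 25\<close> is nearly zero. The difference \<open>\<psi>\<close> to the
  tangent plus a small parabola has derivative \<open>(z - 1) * B z\<close> with \<open>B\<close>
  nonnegative, so it is minimal at 1.\<close>

lemma ln_div_ln2_lower:
  fixes z :: real
  assumes z: "2 / 3 \<le> z" "z \<le> 4 / 3"
  defines "\<kappa> \<equiv> 1 / ln 2"
  shows "12 / 5 + (\<kappa> - 36 / 25) * (z - 1) + (z - 1)\<^sup>2 / 10 \<le> \<kappa> * ln z + 12 / (3 * z + 2)"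
proof -
  define \<psi> where
    "\<psi> z = \<kappa> * ln z + 12 / (3 * z + 2) - 12 / 5 - (\<kappa> - 36 / 25) * (z - 1) - (z - 1)\<^sup>2 / 10" for z :: real
  define B where "B z = 108 * (3 * z + 7) / (25 * (3 * z + 2)\<^sup>2) - \<kappa> / z - 1 / 5" for z :: real
  have \<kappa>: "\<kappa> \<le> 1446 / 1000"
    using ln2_bounds(1) by (simp add: \<kappa>_def divide_le_eq)
  have deriv: "(\<psi> has_real_derivative (z - 1) * B z) (at z)" if "z > 0" for z
  proof -
    have "(\<psi> has_real_derivative
        \<kappa> * (1 / z) - 12 * 3 / (3 * z + 2)\<^sup>2 - (\<kappa> - 36 / 25) - 2 * (z - 1) / 10) (at z)"
      unfolding \<psi>_def using that
      by (auto intro!: derivative_eq_intros simp: power2_eq_square)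
    also have "\<kappa> * (1 / z) - 12 * 3 / (3 * z + 2)\<^sup>2 - (\<kappa> - 36 / 25) - 2 * (z - 1) / 10 = (z - 1) * B z"
    proof -
      have "(3 * z + 2)\<^sup>2 \<noteq> 0" using that by auto
      then have "36 / 25 - 36 / (3 * z + 2)\<^sup>2 = (36 * (3 * z + 2)\<^sup>2 - 900) / (25 * (3 * z + 2)\<^sup>2)"
        by (simp add: divide_simps)
      also have "36 * (3 * z + 2)\<^sup>2 - 900 = (z - 1) * (108 * (3 * z + 7))"
        by (simp add: power2_eq_square algebra_simps)
      finally have "36 / 25 - 36 / (3 * z + 2)\<^sup>2 = (z - 1) * (108 * (3 * z + 7) / (25 * (3 * z + 2)\<^sup>2))"
        by simp
      moreover have "\<kappa> * (1 / z) - \<kappa> = - ((z - 1) * (\<kappa> / z))"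
        using that by (simp add: field_simps)
      moreover have "(z - 1) * B z = (z - 1) * (108 * (3 * z + 7) / (25 * (3 * z + 2)\<^sup>2))
          - (z - 1) * (\<kappa> / z) - (z - 1) / 5"
        by (simp add: B_def right_diff_distrib)
      ultimately show ?thesis by argo
    qed
    finally show ?thesis .
  qed
  have B: "0 \<le> B z" if "2 / 3 \<le> z" "z \<le> 4 / 3" for z
  proof -
    have "(1446 / 1000 + z / 5) * (25 * (3 * z + 2)\<^sup>2) \<le> 108 * (3 * z + 7) * z"
    proof -
      \<comment> \<open>The chord of the square over the interval bounds \<open>z * z\<close>, and
        after multiplication by \<open>z\<close> also the cube, which makes the inequality
        linear.\<close>
      have "0 \<le> (z - 2 / 3) * (4 / 3 - z)" using that by simp
      then have sq: "z * z \<le> 2 * z - 8 / 9" by (simp add: algebra_simps)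
      then have "z * (z * z) \<le> z * (2 * z - 8 / 9)" using that by (intro mult_left_mono) auto
      then show ?thesis using sq that by (simp add: power2_eq_square algebra_simps)
    qed
    moreover have "\<kappa> * (25 * (3 * z + 2)\<^sup>2) \<le> 1446 / 1000 * (25 * (3 * z + 2)\<^sup>2)"
      using \<kappa> by (intro mult_right_mono) auto
    ultimately have "(\<kappa> + z / 5) * (25 * (3 * z + 2)\<^sup>2) \<le> 108 * (3 * z + 7) * z"
      by (simp add: distrib_right)
    moreover have "0 < 25 * (3 * z + 2)\<^sup>2" "0 < z" using that by auto
    ultimately have "(\<kappa> + z / 5) / z \<le> 108 * (3 * z + 7) / (25 * (3 * z + 2)\<^sup>2)"
      by (simp add: divide_le_eq le_divide_eq mult.commute mult.left_commute)
    then show ?thesis using \<open>0 < z\<close> by (simp add: B_def add_divide_distrib)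
  qed
  have "\<psi> 1 \<le> \<psi> z"
  proof (cases "1 \<le> z")
    case True
    show ?thesis
    proof (rule DERIV_nonneg_imp_nondecreasing[OF True])
      fix x assume "1 \<le> x" "x \<le> z"
      then show "\<exists>y. (\<psi> has_real_derivative y) (at x) \<and> 0 \<le> y"
        using deriv[of x] B[of x] z by (intro exI[of _ "(x - 1) * B x"]) auto
    qed
  next
    case False
    then have "z \<le> 1" by simp
    then show ?thesis
    proof (rule DERIV_nonpos_imp_nonincreasing)
      fix x assume "z \<le> x" "x \<le> 1"
      then show "\<exists>y. (\<psi> has_real_derivative y) (at x) \<and> y \<le> 0"
        using deriv[of x] B[of x] z
        by (intro exI[of _ "(x - 1) * B x"]) (auto intro: mult_nonpos_nonneg)
    qed
  qed
  then show ?thesis by (simp add: \<psi>_def)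
qed

text \<open>In terms of \<open>y\<close> the brackets collapse to one fraction and a logarithm;
  \<open>764 = 2292 / 3\<close>.\<close>

lemma cfun_eq:
  assumes y: "y = 2 powr x"
  shows "cfun x = 6 / (y + 1) + x - log 2 3 + 1 / (764 * y)"
proof -
  have pos: "y > 0" by (simp add: y)
  have "2 powr (1 - x) = 2 / y" "2 powr (- x) = 1 / y" "2 powr (log 2 3 - x) = 3 / y"
    by (simp_all add: y powr_diff powr_minus divide_simps)
  then have "cfun x = (3 - log 2 3) - (2 - x - 2 / y) + (1 - 1 / y) * (3 / (y + 1) - 1) + 3 / y / 2292"
    by (simp add: cfun_def y)
  also have "\<dots> = 6 / (y + 1) + x - log 2 3 + 1 / (764 * y)"
    using pos by (simp add: divide_simps) (simp add: algebra_simps)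
  finally show ?thesis .
qed

lemma cfun_lower:
  assumes x: "x \<in> {0..<1}"
  shows "1.4005 \<le> cfun x"
proof -
  define y where "y = 2 powr x"
  \<comment> \<open>Scaled so that the near-minimum at \<open>y = 3 / 2\<close> becomes
    \<open>z = 1\<close>.\<close>
  define z where "z = 2 * y / 3"
  define s where "s = 1 / ln 2 - 36 / (25::real)"
  have "2 powr 0 \<le> 2 powr x" "2 powr x \<le> 2 powr 1"
    using x by (intro powr_mono; simp)+
  then have y: "1 \<le> y" "y \<le> 2" by (auto simp: y_def)
  then have z: "2 / 3 \<le> z" "z \<le> 4 / 3" by (auto simp: z_def)
  have "-6 / 1000 \<le> s" "s \<le> 6 / 1000"
    using ln2_bounds unfolding s_def by (auto simp: field_simps)
  then have s: "s\<^sup>2 \<le> 36 / 1000000"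
  proof -
    assume "- 6 / 1000 \<le> s" "s \<le> 6 / 1000"
    then have "\<bar>s\<bar> \<le> \<bar>6 / 1000\<bar>" by linarith
    then have "s\<^sup>2 \<le> (6 / 1000)\<^sup>2" by (rule abs_le_square_iff[THEN iffD1])
    then show ?thesis by (simp add: power2_eq_square)
  qed
  have "x - log 2 3 = log 2 (y / 3)"
    using y by (simp add: log_divide) (simp add: y_def)
  also have "y / 3 = z / 2" by (simp add: z_def)
  also have "log 2 (z / 2) = 1 / ln 2 * ln z - 1"
    using z by (simp add: log_def ln_div field_simps)
  finally have "x - log 2 3 = 1 / ln 2 * ln z - 1" .
  moreover have "6 / (y + 1) = 12 / (3 * z + 2)" using y by (simp add: z_def field_simps)
  ultimately have "cfun x = 1 / ln 2 * ln z + 12 / (3 * z + 2) - 1 + 1 / (764 * y)"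
    using cfun_eq[OF y_def] by simp
  moreover have "12 / 5 + s * (z - 1) + (z - 1)\<^sup>2 / 10 \<le> 1 / ln 2 * ln z + 12 / (3 * z + 2)"
    using ln_div_ln2_lower[OF z] by (simp add: s_def)
  \<comment> \<open>Completing the square bounds the loss from the slope \<open>s\<close> by
    0.00009. Since \<open>1 / (764 * y)\<close> contributes at least 0.00065, more than 0.0005 is
    left above 1.4.\<close>
  moreover have "(5 * s + (z - 1))\<^sup>2 = 25 * s\<^sup>2 + 10 * (s * (z - 1)) + (z - 1)\<^sup>2"
    by (simp add: power2_eq_square algebra_simps)
  then have "- (36 / 1000000) * (5 / 2) \<le> s * (z - 1) + (z - 1)\<^sup>2 / 10"
    using s zero_le_power2[of "5 * s + (z - 1)"] by linarith
  moreover have "1 / (764 * 2) \<le> 1 / (764 * y)" using y by (intro divide_left_mono) auto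
  ultimately show ?thesis by simp
qed

section \<open>Summing over the batches\<close>

lemma batch_end_near: "\<bar>real (batch_end k) - 2 * 2 ^ k / 3\<bar> \<le> 1 / 3"
proof -
  have "3 * real (batch_end k) = 2 * 2 ^ k + (- 1) ^ k"
    using arg_cong[OF three_batch_end[of k], of real_of_int] by simp
  then show ?thesis by (cases "even k") auto
qed

text \<open>Summation by parts with \<open>batch_end k\<close> replaced by
  \<open>2 * 2 ^ k / 3\<close>; the rounding costs at most 1/3 per batch and is absorbed by the
  summand \<open>q\<close>.\<close>

lemma sum_batch_end:
  assumes "2 \<le> q"
  shows "(\<Sum>k=2..<q. real k * real (batch_end k - batch_end (k - 1))) \<le>
    q * real (batch_end (q - 1)) - 2 * (2 ^ q / 3) + q"
  using assms
proof (induction q rule: dec_induct)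
  case base
  then show ?case by simp
next
  case (step q)
  have "real q * real (batch_end q - batch_end (q - 1)) =
      real q * real (batch_end q) - real q * real (batch_end (q - 1))"
    using batch_end_mono[of "q - 1" q] by (simp add: of_nat_diff right_diff_distrib)
  moreover have "2 * 2 ^ q / 3 - 1 / 3 \<le> real (batch_end q)"
    using batch_end_near[of q] by (simp only: abs_le_iff) linarith
  ultimately show ?case
    using step.IH step.hyps by (simp add: algebra_simps)
qed

text \<open>The value is the binomial coefficient \<open>L + 1\<close> over 3.\<close>

lemma sum_differences:
  "(\<Sum>j=u..<u + L. \<Sum>l\<in>{j<..<u + L}. real (l - j)) = real L * (real L ^ 2 - 1) / 6"
proof (induction L)
  case (Suc L)
  have inner: "(\<Sum>l\<in>{j<..<u + Suc L}. real (l - j)) = (\<Sum>l\<in>{j<..<u + L}. real (l - j)) + real (u + L - j)"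
    if "j < u + L" for j
  proof -
    have "{j<..<u + Suc L} = insert (u + L) {j<..<u + L}" using that by auto
    then show ?thesis by simp
  qed
  have "(\<Sum>j=u..<u + L. real (u + L - j)) = real L * (real L + 1) / 2"
  proof (induction L)
    case (Suc L)
    have "(\<Sum>j=u..<u + Suc L. real (u + Suc L - j)) = (\<Sum>j=u..<u + L. real (u + L - j) + 1) + 1"
      by (auto simp: Suc_diff_le intro!: sum.cong)
    also have "\<dots> = real L * (real L + 1) / 2 + real L + 1" by (simp only: sum.distrib Suc) simp
    also have "\<dots> = real (Suc L) * (real (Suc L) + 1) / 2" by (simp add: field_simps)
    finally show ?case .
  qed simp
  moreover have "{u + L<..<u + Suc L} = {}" by auto
  then have "(\<Sum>j=u..<u + Suc L. \<Sum>l\<in>{j<..<u + Suc L}. real (l - j)) =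
      (\<Sum>j=u..<u + L. \<Sum>l\<in>{j<..<u + Suc L}. real (l - j))" by simp
  moreover have "\<dots> = (\<Sum>j=u..<u + L. (\<Sum>l\<in>{j<..<u + L}. real (l - j)) + real (u + L - j))"
    using inner by (intro sum.cong) auto
  ultimately have "(\<Sum>j=u..<u + Suc L. \<Sum>l\<in>{j<..<u + Suc L}. real (l - j)) =
      real L * (real L ^ 2 - 1) / 6 + real L * (real L + 1) / 2"
    by (simp only: sum.distrib Suc)
  then show ?case by (simp add: field_simps power2_eq_square)
qed simp

text \<open>For \<open>X = 2 ^ k\<close> a complete batch has about \<open>X / 3\<close> elements.
  The coarse bounds \<open>L \<ge> X / 4\<close> and \<open>2 * l + 1 \<le> 2 * X\<close> already
  give \<open>X / 768\<close> to leading order, and for \<open>X \<le> 2292\<close> the claimed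
  bound is not positive.\<close>

lemma saving_ge:
  assumes "2 \<le> k"
  shows "2 ^ k / 2292 - 1 \<le> saving k"
proof (cases "(2::real) ^ k \<le> 2292")
  case True
  have "0 \<le> saving k" unfolding saving_def by (intro divide_nonneg_nonneg sum_nonneg) auto
  moreover have "2 ^ k / 2292 - 1 \<le> (0::real)" using True by simp
  ultimately show ?thesis by linarith
next
  case False
  define X where "X = (2::real) ^ k"
  define u w L where "u = batch_end (k - 1)" and "w = batch_end k" and "L = w - u"
  have X: "X > 2292" using False by (simp add: X_def)
  have "u \<le> w" using batch_end_mono[of "k - 1" k] by (simp add: u_def w_def)
  then have w: "w = u + L" by (simp add: L_def)
  have pow: "2 * (2::real) ^ (k - 1) = 2 ^ k" using assms by (cases k) auto
  have bounds: "\<bar>real u - X / 3\<bar> \<le> 1 / 3" "\<bar>real w - 2 * X / 3\<bar> \<le> 1 / 3"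
    using batch_end_near[of "k - 1"] batch_end_near[of k] pow
    by (simp_all add: u_def w_def X_def)
  have L: "X / 4 \<le> real L" "real w \<le> X" "0 < w"
  proof -
    have "X / 3 - 1 / 3 \<le> real u" "real u \<le> X / 3 + 1 / 3"
      "2 * X / 3 - 1 / 3 \<le> real w" "real w \<le> 2 * X / 3 + 1 / 3"
      using bounds by (simp_all only: abs_le_iff) linarith+
    moreover have "real w = real u + real L" by (simp add: w)
    ultimately have "X / 4 \<le> real L" "real w \<le> X" "0 < real w" using X by linarith+
    then show "X / 4 \<le> real L" "real w \<le> X" "0 < w" by simp_all
  qed
  have "(X / 4) * ((X / 4)\<^sup>2 - 1) / 6 \<le> real L * (real L ^ 2 - 1) / 6"
  proof (intro divide_right_mono mult_mono diff_right_mono power_mono)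
    have "(1::real)\<^sup>2 \<le> (X / 4)\<^sup>2" using X by (intro power_mono) auto
    then show "0 \<le> (X / 4)\<^sup>2 - 1" by simp
  qed (use L X in auto)
  also have "\<dots> = (\<Sum>j=u..<w. \<Sum>l\<in>{j<..<w}. real (l - j))"
    unfolding w by (rule sum_differences[symmetric])
  finally have sum: "(X / 4) * ((X / 4)\<^sup>2 - 1) / 6 \<le> (\<Sum>j=u..<w. \<Sum>l\<in>{j<..<w}. real (l - j))" .
  have "(X / 4) * ((X / 4)\<^sup>2 - 1) / 6 / (2 * X) \<le> (\<Sum>j=u..<w. \<Sum>l\<in>{j<..<w}. real (l - j)) / (2 * X)"
    using sum X by (intro divide_right_mono) auto
  also have "\<dots> = (\<Sum>j=u..<w. \<Sum>l\<in>{j<..<w}. real (l - j) / (2 * X))"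
    by (simp add: sum_divide_distrib)
  also have "\<dots> \<le> (\<Sum>j=u..<w. \<Sum>l\<in>{j<..<w}. real (l - j) / real (2 * l + 1))"
  proof (intro sum_mono divide_left_mono)
    fix j l assume "l \<in> {j<..<w}"
    then have "2 * l + 1 \<le> 2 * w" by auto
    then have "real (2 * l + 1) \<le> real (2 * w)" by (simp only: of_nat_le_iff)
    then show "real (2 * l + 1) \<le> 2 * X" using L(2) by simp
  qed (use X in auto)
  also have "\<dots> = saving k * X"
    by (simp add: saving_def u_def w_def X_def)
  finally have "(X / 4) * ((X / 4)\<^sup>2 - 1) / 6 / (2 * X) / X \<le> saving k"
    using X by (simp add: divide_le_eq)
  moreover have "(X / 4) * ((X / 4)\<^sup>2 - 1) / 6 / (2 * X) / X = X / 768 - 1 / (48 * X)"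
    using X by (simp add: field_simps power2_eq_square)
  ultimately have "X / 768 - 1 / (48 * X) \<le> saving k" by (simp only:)
  moreover have "1 / (48 * X) \<le> 1" using X by (simp add: divide_le_eq)
  moreover have "X / 2292 \<le> X / 768" using X by simp
  ultimately show ?thesis unfolding X_def[symmetric] by linarith
qed

lemma sum_saving_ge:
  assumes "2 \<le> q"
  shows "2 ^ q / 2292 - q \<le> (\<Sum>k=2..<q. saving k)"
  using assms
proof (induction q rule: dec_induct)
  case (step q)
  then show ?case using saving_ge[of q] by simp
qed simp

text \<open>With \<open>3 * A = 2 ^ q\<close>, \<open>T = batch_end (q - 1)\<close> and
  \<open>z = N\<close> this is the saving in the last batch: \<open>z - T\<close> insertions, each
  saving \<open>2 ^ q / (T + z) - 1\<close>.\<close>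

definition tail_saving :: "real \<Rightarrow> real \<Rightarrow> real \<Rightarrow> real" where
  "tail_saving A T z = (z - T) * (3 * A / (T + z) - 1)"

text \<open>The division by \<open>T + z\<close> is isolated so that the Lipschitz bounds can be read off.\<close>
lemma tail_saving_eq:
  assumes "0 < T + z"
  shows "tail_saving A T z = 3 * A - 6 * (A * (T / (T + z))) - z + T"
  using assms by (simp add: tail_saving_def field_simps)

text \<open>Replaces the integer threshold by its ideal value \<open>A\<close>. Both quotients are
  at most 1, so the change is at most \<open>6 * (1 / 3) + 1 / 3\<close>, whatever the size of
  \<open>A\<close>.\<close>

lemma tail_saving_threshold:
  assumes "0 < A" "0 < T" "0 < z" "\<bar>T - A\<bar> \<le> 1 / 3"
  shows "tail_saving A A z - 3 \<le> tail_saving A T z"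
proof -
  have "A * (T / (T + z) - A / (A + z)) = (T - A) * (A / (A + z) * (z / (T + z)))"
    using assms by (simp add: field_simps)
  also have "\<dots> \<le> \<bar>(T - A) * (A / (A + z) * (z / (T + z)))\<bar>" by (rule abs_ge_self)
  also have "\<dots> = \<bar>T - A\<bar> * (A / (A + z) * (z / (T + z)))"
    using assms by (simp add: abs_mult)
  also have "\<dots> \<le> 1 / 3 * (1 * 1)"
    using assms by (intro mult_mono) auto
  finally have "A * (T / (T + z)) - A * (A / (A + z)) \<le> 1 / 3"
    by (simp only: right_diff_distrib)
  then show ?thesis
    using assms tail_saving_eq[of T z A] tail_saving_eq[of A z A] by (simp only: abs_le_iff) linarith
qed

text \<open>The term \<open>A * (A / (A + z))\<close> is 1-Lipschitz and enters with factor 6; the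
  linear term adds 1.\<close>

lemma tail_saving_lipschitz:
  assumes "0 < A" "0 \<le> z" "0 \<le> z'"
  shows "tail_saving A A z \<le> tail_saving A A z' + 7 * \<bar>z - z'\<bar>"
proof -
  have "A * (A / (A + z)) - A * (A / (A + z')) = (z' - z) * (A / (A + z) * (A / (A + z')))"
    using assms by (simp add: field_simps)
  then have "\<bar>A * (A / (A + z)) - A * (A / (A + z'))\<bar> = \<bar>z' - z\<bar> * (A / (A + z) * (A / (A + z')))"
    using assms by (simp add: abs_mult)
  also have "\<dots> \<le> \<bar>z' - z\<bar> * (1 * 1)"
    using assms by (intro mult_mono) auto
  finally have "\<bar>A * (A / (A + z)) - A * (A / (A + z'))\<bar> \<le> \<bar>z - z'\<bar>" by (simp add: abs_minus_commute)
  then have "A * (A / (A + z')) - A * (A / (A + z)) \<le> \<bar>z - z'\<bar>" by linarith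
  moreover have "tail_saving A A z = 3 * A - 6 * (A * (A / (A + z))) - z + A"
    "tail_saving A A z' = 3 * A - 6 * (A * (A / (A + z'))) - z' + A"
    using assms by (simp_all only: tail_saving_eq add_pos_nonneg)
  moreover have "z' - z \<le> \<bar>z - z'\<bar>" by simp
  ultimately show ?thesis by argo
qed

section \<open>The recursion for the main term\<close>

text \<open>
  \<open>n log\<^sub>2 n - c(x\<^sub>n) n\<close> for \<open>2\<^sup>k \<le> 3 n < 2\<^sup>k\<^sup>+\<^sup>1\<close>. For fixed \<open>k\<close> it has no discontinuity where \<open>x\<^sub>n\<close>
  wraps around, so rounding \<open>n / 2\<close> in the recursion is harmless.
\<close>
definition main_term :: "nat \<Rightarrow> real \<Rightarrow> real" where
  "main_term k z = (real k - 1) * z - 2 * (2 ^ k / 3) - tail_saving (2 ^ k / 3) (2 ^ k / 3) z - 2 ^ k / 2292"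

text \<open>\<open>tail_saving\<close> is homogeneous of degree 1, so \<open>main_term\<close>
  solves the recursion exactly: for \<open>n = 2 * z\<close> the leading \<open>z\<close> counts the
  pair comparisons and the bracket is the insertion cost without its error.\<close>

lemma main_term_double:
  assumes "0 \<le> z"
  shows "z + main_term q z + (real q * z - 2 * (2 ^ q / 3) - tail_saving (2 ^ q / 3) (2 ^ q / 3) z - 2 ^ q / 2292)
    = main_term (Suc q) (2 * z)"
proof -
  define A where "A = (2::real) ^ q / 3"
  have A: "A > 0" by (simp add: A_def)
  have "tail_saving (2 * A) (2 * A) (2 * z) = 2 * tail_saving A A z"
    using A assms by (simp add: tail_saving_eq field_simps)
  moreover have "(2::real) ^ Suc q / 3 = 2 * A" "(2::real) ^ Suc q / 2292 = 2 * (2 ^ q / 2292)"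
    by (simp_all add: A_def)
  ultimately show ?thesis
    unfolding main_term_def A_def[symmetric] by (simp add: algebra_simps)
qed

lemma avg_insert_cost_le_main:
  assumes q: "2 \<le> q" "batch_end (q - 1) \<le> N" "N \<le> batch_end q"
    and m: "m \<le> N" "N \<le> Suc m" and ne: "configs m N \<noteq> {}"
  shows "(\<Sum>v\<in>configs m N. real (total_insert_cost m N v)) / card (configs m N) \<le>
    real q * N - 2 * (2 ^ q / 3) - tail_saving (2 ^ q / 3) (2 ^ q / 3) N - 2 ^ q / 2292 + 2 * real q + 3"
proof -
  define A T where "A = (2::real) ^ q / 3" and "T = real (batch_end (q - 1))"
  have A: "A > 0" by (simp add: A_def)
  have pow: "2 * (2::real) ^ (q - 1) = 2 ^ q" using q by (cases q) auto
  have near: "\<bar>T - A\<bar> \<le> 1 / 3" using batch_end_near[of "q - 1"] pow by (simp add: T_def A_def)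
  have "1 \<le> batch_end (q - 1)" using batch_end_mono[of 1 "q - 1"] q by simp
  then have T: "0 < T" "0 < real N" using q by (auto simp: T_def)
  have tail: "tail_saving A T N = real (N - batch_end (q - 1)) * (2 ^ q / (batch_end (q - 1) + N) - 1)"
    using q by (simp add: tail_saving_def A_def T_def of_nat_diff)
  have "real (N - batch_end (q - 1)) * (q - (2 ^ q / (batch_end (q - 1) + N) - 1)) =
      real q * (N - T) - tail_saving A T N"
    unfolding tail using q by (simp add: T_def of_nat_diff algebra_simps)
  then have "(\<Sum>v\<in>configs m N. real (total_insert_cost m N v)) / card (configs m N) \<le>
    (\<Sum>k=2..<q. real k * real (batch_end k - batch_end (k - 1))) - (\<Sum>k=2..<q. saving k) +
      (real q * (N - T) - tail_saving A T N)"
    using avg_insert_cost_le[OF m q ne] by (simp only: sum_subtractf)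
  also have "\<dots> \<le> (q * T - 2 * A + q) - (2 ^ q / 2292 - q) + (real q * (N - T) - (tail_saving A A N - 3))"
    using sum_batch_end[OF q(1)] sum_saving_ge[OF q(1)] tail_saving_threshold[OF A T near]
    unfolding A_def T_def by linarith
  also have "\<dots> = real q * N - 2 * A - tail_saving A A N - 2 ^ q / 2292 + 2 * real q + 3"
    by (simp add: algebra_simps)
  finally show ?thesis by (simp add: A_def)
qed

text \<open>The window for \<open>n\<close> reproduces itself under halving with rounding down: from
  \<open>2 * A - 1 \<le> n\<close> follows \<open>m \<ge> A - 1\<close>. It also forces
  \<open>N\<close> into batch \<open>q\<close>, so level and last batch stay in step. Errors linear
  in \<open>k\<close> per level sum to the quadratic term.\<close>

lemma avg_comparisons_le_main_term:
  fixes C :: real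
  assumes base: "avg_comparisons 1 \<le> main_term 2 1 + C" "avg_comparisons 2 \<le> main_term 2 2 + C"
  assumes "2 \<le> k" "2 ^ k / 3 - 1 \<le> real n" "real n \<le> 2 * (2 ^ k / 3)"
  shows "avg_comparisons n \<le> main_term k n + C + 14 * real k ^ 2"
  using assms(3-)
proof (induction k arbitrary: n rule: dec_induct)
  case base
  \<comment> \<open>For \<open>k = 2\<close> the window is from 1/3 to 8/3.\<close>
  then have "n \<noteq> 0" "real n < 3" by (auto intro: ccontr)
  then have "n = 1 \<or> n = 2" by auto
  then show ?case using assms(1,2) by (auto simp: field_simps)
next
  case (step q)
  define m N A where "m = n div 2" and "N = n - m" and "A = (2::real) ^ q / 3"
  have A: "0 < A" "4 \<le> 3 * A" using power_increasing[OF step.hyps(1), of "2::real"] by (auto simp: A_def)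
  have n: "2 * A - 1 \<le> real n" "real n \<le> 4 * A" using step.prems by (simp_all add: A_def)
  then have "1 < real n" using A by linarith
  then have n2: "2 \<le> n" by linarith
  have mN: "m \<le> N" "N \<le> Suc m" "n = m + N" by (auto simp: m_def N_def)
  have m: "real n / 2 - 1 / 2 \<le> real m" "real m \<le> real n / 2" and N: "real n / 2 \<le> real N" "real N \<le> real n / 2 + 1 / 2"
    using mN by linarith+
  have pow: "2 * (2::real) ^ (q - 1) = 2 ^ q" using step.hyps(1) by (cases q) auto
  have near: "\<bar>real (batch_end (q - 1)) - A\<bar> \<le> 1 / 3" "\<bar>real (batch_end q) - 2 * A\<bar> \<le> 1 / 3"
    using batch_end_near[of "q - 1"] batch_end_near[of q] pow by (simp_all add: A_def)
  \<comment> \<open>The roundings add up to less than 1, so strict bounds against successors give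
    the exact integer inequalities.\<close>
  have "real (batch_end (q - 1)) < real (Suc N)" "real N < real (Suc (batch_end q))"
    using near n N unfolding abs_le_iff of_nat_Suc by linarith+
  then have q: "batch_end (q - 1) \<le> N" "N \<le> batch_end q" by auto
  have ne: "configs m N \<noteq> {}" by (rule avg_comparisons_rec(1)[OF n2 m_def N_def])
  have "avg_comparisons n = m + avg_comparisons m +
      (\<Sum>v\<in>configs m N. real (total_insert_cost m N v)) / card (configs m N)"
    by (rule avg_comparisons_rec(2)[OF n2 m_def N_def])
  also have "\<dots> \<le> real n / 2 + (main_term q m + C + 14 * real q ^ 2) +
      (real q * N - 2 * A - tail_saving A A N - 2 ^ q / 2292 + 2 * real q + 3)"
  proof (intro add_mono)
    show "avg_comparisons m \<le> main_term q m + C + 14 * real q ^ 2"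
      using m n by (intro step.IH) (simp_all add: A_def)
  qed (use m avg_insert_cost_le_main[OF step.hyps(1) q mN(1,2) ne] in \<open>simp_all add: A_def\<close>)
  finally have "avg_comparisons n \<le> real n / 2 + (main_term q m + C + 14 * real q ^ 2) +
      (real q * N - 2 * A - tail_saving A A N - 2 ^ q / 2292 + 2 * real q + 3)" .
  moreover have "main_term q m \<le> main_term q (real n / 2) + 7 / 2"
  proof -
    have "(real q - 1) * m \<le> (real q - 1) * (real n / 2)"
      using m step.hyps(1) by (intro mult_left_mono) auto
    moreover have "tail_saving A A (real n / 2) \<le> tail_saving A A m + 7 * \<bar>real n / 2 - m\<bar>"
      by (rule tail_saving_lipschitz) (use A in auto)
    moreover have "\<bar>real n / 2 - m\<bar> \<le> 1 / 2" using m by (simp add: abs_le_iff)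
    ultimately show ?thesis unfolding main_term_def A_def[symmetric] by argo
  qed
  moreover have "real q * N \<le> real q * (real n / 2) + real q / 2"
  proof -
    have "real q * N \<le> real q * (real n / 2 + 1 / 2)" using N by (intro mult_left_mono) auto
    then show ?thesis by (simp add: distrib_left)
  qed
  moreover have "tail_saving A A (real n / 2) - 7 / 2 \<le> tail_saving A A N"
  proof -
    have "tail_saving A A (real n / 2) \<le> tail_saving A A N + 7 * \<bar>real n / 2 - N\<bar>"
      by (rule tail_saving_lipschitz) (use A in auto)
    moreover have "\<bar>real n / 2 - N\<bar> \<le> 1 / 2" using N by (simp add: abs_le_iff)
    ultimately show ?thesis by argo
  qed
  moreover have "real n / 2 + main_term q (real n / 2) +
      (real q * (real n / 2) - 2 * A - tail_saving A A (real n / 2) - 2 ^ q / 2292) = main_term (Suc q) n"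
    using main_term_double[of "real n / 2" q] by (simp add: A_def)
  \<comment> \<open>\<open>2 * q + 3\<close> comes from the insertion cost, \<open>q / 2\<close> and
    twice \<open>7 / 2\<close> from replacing \<open>N\<close> and \<open>m\<close> by
    \<open>n / 2\<close>; the increment of \<open>14 * q ^ 2\<close> is larger.\<close>
  ultimately have "avg_comparisons n \<le> main_term (Suc q) n + C + 14 * real q ^ 2 + 5 / 2 * real q + 10"
    by argo
  then show ?case by (simp add: power2_eq_square algebra_simps)
qed

text \<open>\<open>k\<close> is the integer part of \<open>log 2 (3 * n)\<close>, hence
  \<open>2 powr xfrac n = n / A\<close> with \<open>A = 2 ^ k / 3\<close>, and each summand of
  \<open>n * cfun (xfrac n)\<close> becomes one of \<open>main_term\<close>.\<close>

lemma main_term_eq: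
  assumes "1 \<le> n"
  shows "\<exists>k::nat. 1 \<le> k \<and> real k \<le> log 2 (3 * real n) \<and> 2 ^ k / 3 \<le> real n \<and> real n \<le> 2 * (2 ^ k / 3) \<and>
    real n * log 2 (real n) - cfun (xfrac n) * real n = main_term k n"
proof -
  define l where "l = log 2 (3 * real n)"
  define k where "k = nat \<lfloor>l\<rfloor>"
  have "log 2 2 \<le> l" unfolding l_def using assms by (intro log_mono) auto
  then have l: "1 \<le> l" by simp
  then have k: "real k = real_of_int \<lfloor>l\<rfloor>" by (simp add: k_def)
  have k1: "1 \<le> k" using l by (simp add: k_def le_nat_iff)
  have x: "xfrac n = l - k" by (simp add: xfrac_def l_def[symmetric] frac_def k)
  have kl: "real k \<le> l" "l < real k + 1" using k by linarith+
  define A y where "A = (2::real) ^ k / 3" and "y = 2 powr xfrac n"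
  have A: "A > 0" by (simp add: A_def)
  have "2 powr l = 3 * real n" using assms by (simp add: l_def)
  then have y: "y = real n / A"
    by (simp add: y_def x powr_diff powr_realpow A_def)
  have "2 powr 0 \<le> y" "y \<le> 2 powr 1"
    unfolding y_def using kl by (intro powr_mono; simp add: x)+
  then have bounds: "A \<le> real n" "real n \<le> 2 * A" using A by (simp_all add: y field_simps)
  have n: "real n > 0" using assms by simp
  have "log 2 (real n) = l - log 2 3" using assms by (simp add: l_def log_mult)
  then have "real n * log 2 (real n) - cfun (xfrac n) * real n =
      real n * (l - log 2 3) - real n * (6 / (y + 1) + (l - k) - log 2 3 + 1 / (764 * y))"
    using cfun_eq[OF y_def] by (simp only: x mult.commute)
  also have "\<dots> = real k * n - n * (6 / (y + 1)) - n * (1 / (764 * y))"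
    by (simp add: algebra_simps)
  also have "n * (1 / (764 * y)) = 2 ^ k / 2292"
    using n A by (simp add: y) (simp add: A_def)
  also have "n * (6 / (y + 1)) = 6 * (A * (n / (A + n)))"
    using n A by (simp add: y field_simps)
  also have "A * (n / (A + n)) = A - A * (A / (A + n))"
    using n A by (simp add: field_simps)
  also have "real k * n - 6 * (A - A * (A / (A + n))) - 2 ^ k / 2292 = main_term k n"
    using tail_saving_eq[of A n A] n A
    by (simp add: main_term_def A_def[symmetric] algebra_simps)
  finally show ?thesis
    using k1 kl(1) bounds unfolding l_def A_def by blast
qed

theorem theorem3:
  shows "(\<exists>g :: nat \<Rightarrow> real. g \<in> O(\<lambda>n. (log 2 (real n))\<^sup>2) \<and>
           (\<forall>n\<ge>1. avg_comparisons n
              \<le> real n * log 2 (real n) - cfun (xfrac n) * real n + g n))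
       \<and> (\<forall>x\<in>{0..<1}. cfun x \<ge> 1.4005)
       \<and> (\<exists>g :: nat \<Rightarrow> real. g \<in> O(\<lambda>n. (log 2 (real n))\<^sup>2) \<and>
           (\<forall>n\<ge>1. avg_comparisons n
              \<le> real n * log 2 (real n) - 1.4005 * real n + g n))"
proof -
  define C where "C = max 0 (max (avg_comparisons 1 - main_term 2 1) (avg_comparisons 2 - main_term 2 2))"
  \<comment> \<open>\<open>126 = 14 * 9\<close>, from \<open>k \<le> 3 * log 2 n\<close> for
    \<open>n \<ge> 2\<close>. At \<open>n = 1\<close> the logarithm vanishes, so the extra summand
    must cover that value.\<close>
  define g where "g n = (C + 126) * (log 2 (real n))\<^sup>2 +
    (if n = 1 then \<bar>avg_comparisons 1 + cfun (xfrac 1)\<bar> else 0)" for n :: nat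
  have g: "g \<in> O(\<lambda>n. (log 2 (real n))\<^sup>2)"
  proof (rule bigoI[of _ "C + 126"])
    show "\<forall>\<^sub>F n in sequentially. norm (g n) \<le> (C + 126) * norm ((log 2 (real n))\<^sup>2)"
      using eventually_gt_at_top[of 1]
      by eventually_elim (simp add: g_def C_def abs_mult)
  qed
  have bound: "avg_comparisons n \<le> real n * log 2 (real n) - cfun (xfrac n) * real n + g n"
    if n: "1 \<le> n" for n
  proof (cases "n = 1")
    case True
    then show ?thesis by (simp add: g_def)
  next
    case False
    then have n2: "2 \<le> n" using n by simp
    obtain k where k: "1 \<le> k" "real k \<le> log 2 (3 * real n)" "2 ^ k / 3 \<le> real n" "real n \<le> 2 * (2 ^ k / 3)"
      and eq: "real n * log 2 (real n) - cfun (xfrac n) * real n = main_term k n"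
      using main_term_eq[OF n] by blast
    have "k \<noteq> 1" using k(4) n2 by auto
    then have "2 \<le> k" using k(1) by simp
    then have "avg_comparisons n \<le> main_term k n + C + 14 * real k ^ 2"
      using k by (intro avg_comparisons_le_main_term) (auto simp: C_def)
    moreover have "C + 14 * real k ^ 2 \<le> g n"
    proof -
      define l where "l = log 2 (real n)"
      have "log 2 2 \<le> l" unfolding l_def using n2 by (intro log_mono) auto
      then have l: "1 \<le> l" by simp
      have "log 2 3 \<le> log 2 4" by simp
      also have "log 2 (4::real) = 2" using log_pow_cancel[of 2 2] by simp
      finally have "log 2 3 \<le> 2" .
      moreover have "log 2 (3 * real n) = log 2 3 + l" using n2 by (simp add: l_def log_mult)
      ultimately have "log 2 (3 * real n) \<le> 3 * l" using l by linarith
      then have "real k \<le> 3 * l" using k(2) by simp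
      then have "real k ^ 2 \<le> (3 * l)\<^sup>2" by (intro power_mono) auto
      moreover have "C * 1 \<le> C * l\<^sup>2" using l by (intro mult_left_mono one_le_power) (auto simp: C_def)
      ultimately show ?thesis
        using False by (simp add: g_def l_def[symmetric] power_mult_distrib algebra_simps)
    qed
    ultimately show ?thesis by (simp only: eq)
  qed
  have weaker: "avg_comparisons n \<le> real n * log 2 (real n) - 1.4005 * real n + g n"
    if n: "1 \<le> n" for n
  proof -
    have "1.4005 \<le> cfun (xfrac n)"
      by (rule cfun_lower) (simp add: xfrac_def frac_ge_0 frac_lt_1)
    then have "1.4005 * real n \<le> cfun (xfrac n) * real n" by (intro mult_right_mono) auto
    then show ?thesis using bound[OF n] by linarith
  qed
  show ?thesis using g bound weaker cfun_lower by blast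
qed

end
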